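(* Let $X$ be a real Banach space and let $C\subset X$ be a closed convex set. Then the following are equivalent: (i) the set $C$ has the Radon–Nikodým property; (ii) for every metric space $(M,d)$, every continuous map $f\colon C\to M$ is dentable; (iii) every Lipschitz function $f\colon C\to\mathbb R$ is dentable.
   Context: An open half-space of $X$ is a set $\{x\in X: x^*(x)>a\}$ with $x^*\in X^*$, $a\in\mathbb R$. A map $f\colon C\to M$ into a metric space is dentable if for every nonempty bounded $A\subset C$ and every $\varepsilon>0$ there is an open half-space $H$ with $A\cap H\neq\emptyset$ and $\operatorname{diam}(f(A\cap H))<\varepsilon$. A closed convex set $C$ has the Radon–Nikodým property if and only if (Rieffel's characterisation, which may be taken as the definition) the identity map $C\to(C,\|\cdot\|)$ is dentable. *)

theory Defs
  imports "HOL-Analysis.Analysis"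
begin

definition open_halfspace :: "'a::real_normed_vector set \<Rightarrow> bool" where
  "open_halfspace H \<longleftrightarrow> (\<exists>(\<phi> :: 'a \<Rightarrow>\<^sub>L real) a. H = {x. blinfun_apply \<phi> x > a})"

text \<open>Extended-valued, so that an unbounded set has diameter \<open>\<infinity>\<close>; the library's
  \<^const>\<open>diameter\<close> is real-valued and tied to a type class metric.\<close>

definition diam :: "('m \<Rightarrow> 'm \<Rightarrow> real) \<Rightarrow> 'm set \<Rightarrow> ennreal" where
  "diam d S = (SUP x\<in>S. SUP y\<in>S. ennreal (d x y))"

text \<open>The carrier of the target space need not be mentioned: only the values of \<open>d\<close>
  on \<open>f ` C\<close> matter.\<close>

definition dentable_on ::
  "'a::real_normed_vector set \<Rightarrow> ('m \<Rightarrow> 'm \<Rightarrow> real) \<Rightarrow> ('a \<Rightarrow> 'm) \<Rightarrow> bool" where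
  "dentable_on C d f \<longleftrightarrow>
     (\<forall>A. A \<subseteq> C \<and> A \<noteq> {} \<and> bounded A \<longrightarrow>
       (\<forall>\<epsilon>>0. \<exists>H. open_halfspace H \<and> A \<inter> H \<noteq> {} \<and> diam d (f ` (A \<inter> H)) < ennreal \<epsilon>))"

text \<open>The Radon--Nikodym property, defined for closed convex sets through Rieffel's
  characterisation: the identity into the set with its norm metric is dentable.\<close>

definition radon_nikodym_property :: "'a::real_normed_vector set \<Rightarrow> bool" where
  "radon_nikodym_property C \<longleftrightarrow> dentable_on C dist (\<lambda>x. x)"

text \<open>HOL cannot quantify over types inside a formula, so ``every metric space'' is stated
  with explicit carriers (\<^locale>\<open>Metric_space\<close>). For maps from a set of points of type
  \<open>'a\<close>, carriers inside \<open>'a\<close> suffice up to isometry: the image injects into the domain.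
  Carriers in an arbitrary type \<open>'m\<close> are treated separately as a free type variable.\<close>

end

(* (i) implies (ii): Given a bounded A in C and a slice of A, the Radon-Nikodym property yields a
   subslice of A of small diameter. Iterating, slices of A shrink to a point of C, and continuity
   there makes the oscillation of f small on one of them.
   For the subslices: otherwise every point x of the slice is nearly a convex combination of points
   of A far from x or outside the slice. Following these combinations gives a random walk which is
   killed on leaving the slice; it survives with positive probability because the functional that
   defines the slice is nearly a martingale along it. The barycentres of the walk conditioned
   on survival form a bounded subset of C, each an average of its successors; with large
   probability the survival probability gets close to 1, so jumps remain large, and this subset is
   not dentable.

   (iii) implies (i): if slices of A are all large, they are not even covered by finitely many small
   balls. One can thus choose finite subsets N 0, N 1, ... of A at mutual distance at least d such
   that each is contained in the closed convex hull of the union of the later ones of either parity.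
   The distance to the union of the N k with k even is not dentable. *)

theory Submission
  imports Defs
begin

section \<open>Separation of a point from a convex set\<close>

text \<open>Equality for positive scalars follows by applying the inequality also to
  \<open>inverse c\<close>; the inequality is the form that infima inherit directly.\<close>

definition sublinear :: "('a::real_vector \<Rightarrow> real) \<Rightarrow> bool" where
  "sublinear q \<longleftrightarrow> (\<forall>x y. q (x + y) \<le> q x + q y) \<and> (\<forall>c>0. \<forall>x. q (c *\<^sub>R x) \<le> c * q x)"

lemma sublinearD:
  assumes "sublinear q"
  shows sublinear_add: "q (x + y) \<le> q x + q y"
    and sublinear_scale: "c > 0 \<Longrightarrow> q (c *\<^sub>R x) = c * q x"
    and sublinear_0: "q 0 = 0"
    and sublinear_minus: "- q (- x) \<le> q x"
proof -
  have le: "q (c *\<^sub>R x) \<le> c * q x" if "c > 0" for c x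
    using assms that by (auto simp: sublinear_def)
  show add: "q (x + y) \<le> q x + q y" for x y
    using assms by (auto simp: sublinear_def)
  show scale: "q (c *\<^sub>R x) = c * q x" if "c > 0" for c x
    using le[OF that, of x] le[of "inverse c" "c *\<^sub>R x"] that
    by (simp add: field_simps)
  show z: "q 0 = 0"
    using scale[of 2 0] by simp
  show "- q (- x) \<le> q x"
    using add[of x "- x"] z by simp
qed

text \<open>Zorn's lemma downwards. The pointwise infimum of a chain is finite because each member
  stays above \<open>- p (- y)\<close>, and it is subadditive because any two members of a chain
  have a common lower member. The minimal elements turn out to be linear, which gives the
  Hahn-Banach theorem without extending from subspaces.\<close>

lemma exists_minimal_sublinear:
  fixes p :: "'a::real_vector \<Rightarrow> real"
  assumes p: "sublinear p"
  shows "\<exists>q. sublinear q \<and> q \<le> p \<and> (\<forall>r. sublinear r \<and> r \<le> q \<longrightarrow> r = q)"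
proof -
  let ?S = "{q. sublinear q \<and> q \<le> p}"
  have po: "partial_order_on ?S (relation_of (\<ge>) ?S)"
    by (rule partial_order_on_relation_ofI) auto
  have chain: "\<exists>u\<in>?S. \<forall>a\<in>K. a \<ge> u" if K: "K \<in> Chains (relation_of (\<ge>) ?S)" for K
  proof (cases "K = {}")
    case True
    then show ?thesis using p by auto
  next
    case False
    have KS: "sublinear q" "q \<le> p" if "q \<in> K" for q
      using K that by (auto simp: Chains_def relation_of_def)
    have tot: "q \<le> r \<or> r \<le> q" if "q \<in> K" "r \<in> K" for q r
      using K that by (auto simp: Chains_def relation_of_def)
    define u where "u y = (INF q\<in>K. q y)" for y
    have bdd: "bdd_below ((\<lambda>q. q y) ` K)" for y
    proof (rule bdd_belowI2)
      fix q assume "q \<in> K"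
      then show "- p (- y) \<le> q y"
        using sublinear_minus[OF KS(1), of q y] le_funD[OF KS(2), of q "- y"] by simp
    qed
    have u_le: "u y \<le> q y" if "q \<in> K" for q y
      unfolding u_def by (rule cINF_lower[OF bdd that])
    have le_u: "b \<le> u y" if "\<And>q. q \<in> K \<Longrightarrow> b \<le> q y" for b y
      unfolding u_def by (rule cINF_greatest[OF False that])
    have "u (x + y) \<le> u x + u y" for x y
    proof -
      have *: "u (x + y) \<le> q x + r y" if qr: "q \<in> K" "r \<in> K" for q r
      proof -
        obtain s where s: "s \<in> K" "s \<le> q" "s \<le> r" using tot[OF qr] qr by blast
        have "u (x + y) \<le> s x + s y"
          using u_le[OF s(1), of "x + y"] sublinear_add[OF KS(1)[OF s(1)], of x y] by simp
        also have "\<dots> \<le> q x + r y" using s by (intro add_mono) (auto simp: le_fun_def)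
        finally show ?thesis .
      qed
      have "u (x + y) - q x \<le> u y" if "q \<in> K" for q
        using *[OF that] by (intro le_u) (simp add: algebra_simps)
      then have "u (x + y) - u y \<le> u x"
        by (intro le_u) (simp add: algebra_simps)
      then show ?thesis by simp
    qed
    moreover have "u (c *\<^sub>R x) \<le> c * u x" if "c > 0" for c x
    proof -
      have "u (c *\<^sub>R x) / c \<le> u x"
        using u_le[of _ "c *\<^sub>R x"] sublinear_scale[OF KS(1) that] that
        by (intro le_u) (simp add: field_simps)
      then show ?thesis using that by (simp add: field_simps)
    qed
    ultimately have "sublinear u" by (simp add: sublinear_def)
    moreover have "u \<le> p"
    proof -
      obtain q where "q \<in> K" using False by auto
      then show ?thesis using u_le KS(2) by (meson le_funI order_trans)
    qed
    ultimately show ?thesis using u_le by (auto simp: le_fun_def)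
  qed
  from predicate_Zorn[OF po chain] show ?thesis
    by (metis (mono_tags, lifting) mem_Collect_eq order_trans)
qed

text \<open>Lowering \<open>q\<close> along the direction \<open>v\<close> gives another sublinear
  function \<open>r\<close> below \<open>q\<close>. Minimality forces \<open>r = q\<close>, and the
  term \<open>t = 1\<close> of the infimum is then the missing half of additivity.\<close>

lemma minimal_sublinear_add:
  fixes q :: "'a::real_vector \<Rightarrow> real"
  assumes q: "sublinear q" and min: "\<And>r. sublinear r \<Longrightarrow> r \<le> q \<Longrightarrow> r = q"
  shows "q (y + v) = q y + q v"
proof -
  define r where "r y = (INF t\<in>{0..}. q (y + t *\<^sub>R v) - t * q v)" for y
  have scale0: "q (t *\<^sub>R x) = t * q x" if "t \<ge> 0" for t x
    using sublinear_scale[OF q, of t x] sublinear_0[OF q] that by (cases "t = 0") auto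
  have bdd: "bdd_below ((\<lambda>t. q (y + t *\<^sub>R v) - t * q v) ` {0..})" for y
  proof (rule bdd_belowI2)
    fix t :: real assume "t \<in> {0..}"
    then show "- q (- y) \<le> q (y + t *\<^sub>R v) - t * q v"
      using sublinear_add[OF q, of "y + t *\<^sub>R v" "- y"] scale0[of t v] by simp
  qed
  have r_le: "r y \<le> q (y + t *\<^sub>R v) - t * q v" if "t \<ge> 0" for y t
    unfolding r_def by (rule cINF_lower[OF bdd]) (use that in auto)
  have le_r: "b \<le> r y" if "\<And>t. t \<ge> 0 \<Longrightarrow> b \<le> q (y + t *\<^sub>R v) - t * q v" for b y
    unfolding r_def by (rule cINF_greatest) (use that in auto)
  have "r (x + y) \<le> r x + r y" for x y
  proof -
    have *: "r (x + y) \<le> (q (x + s *\<^sub>R v) - s * q v) + (q (y + t *\<^sub>R v) - t * q v)"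
      if "s \<ge> 0" "t \<ge> 0" for s t
      using r_le[of "s + t" "x + y"] sublinear_add[OF q, of "x + s *\<^sub>R v" "y + t *\<^sub>R v"] that
      by (simp add: algebra_simps)
    have "r (x + y) - (q (x + s *\<^sub>R v) - s * q v) \<le> r y" if "s \<ge> 0" for s
      using *[OF that] by (intro le_r) (simp add: algebra_simps)
    then have "r (x + y) - r y \<le> r x"
      by (intro le_r) (simp add: algebra_simps)
    then show ?thesis by simp
  qed
  moreover have "r (c *\<^sub>R x) \<le> c * r x" if "c > 0" for c x
  proof -
    have "r (c *\<^sub>R x) / c \<le> r x"
    proof (rule le_r)
      fix t :: real assume t: "t \<ge> 0"
      have "r (c *\<^sub>R x) \<le> q (c *\<^sub>R (x + t *\<^sub>R v)) - (c * t) * q v"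
        using r_le[of "c * t" "c *\<^sub>R x"] t that by (simp add: algebra_simps)
      then have "r (c *\<^sub>R x) \<le> c * (q (x + t *\<^sub>R v) - t * q v)"
        by (simp only: sublinear_scale[OF q that] right_diff_distrib mult.assoc)
      then show "r (c *\<^sub>R x) / c \<le> q (x + t *\<^sub>R v) - t * q v"
        using that by (simp only: pos_divide_le_eq mult.commute)
    qed
    then show ?thesis using that by (simp add: field_simps)
  qed
  ultimately have "sublinear r" by (simp add: sublinear_def)
  moreover have "r \<le> q"
    using r_le[of 0] by (auto simp: le_fun_def)
  ultimately have "r = q" by (rule min)
  with r_le[of 1 y] have "q y + q v \<le> q (y + v)" by simp
  with sublinear_add[OF q, of y v] show ?thesis by simp
qed

lemma linear_below_sublinear:
  fixes p :: "'a::real_vector \<Rightarrow> real"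
  assumes "sublinear p"
  shows "\<exists>q. linear q \<and> (\<forall>x. q x \<le> p x)"
proof -
  obtain q where q: "sublinear q" "q \<le> p" and min: "\<And>r. sublinear r \<Longrightarrow> r \<le> q \<Longrightarrow> r = q"
    using exists_minimal_sublinear[OF assms] by blast
  have add: "q (x + y) = q x + q y" for x y
    by (rule minimal_sublinear_add[OF q(1) min])
  have neg: "q (- x) = - q x" for x
    using add[of x "- x"] sublinear_0[OF q(1)] by simp
  have "q (c *\<^sub>R x) = c * q x" for c x
    using sublinear_scale[OF q(1), of c x] sublinear_scale[OF q(1), of "- c" x]
      sublinear_0[OF q(1)] neg[of "c *\<^sub>R x"]
    by (cases c "0::real" rule: linorder_cases) auto
  then have "linear q" by (intro linearI) (auto simp: add)
  then show ?thesis using q(2) by (auto simp: le_fun_def)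
qed

text \<open>A linear functional below the sublinear \<open>p\<close> defined here does the job: the
  terms with \<open>t = 0\<close> bound it by the norm, and the term \<open>t = 1\<close> at
  \<open>k - x\<close> bounds it there by \<open>- d\<close>, where \<open>d\<close> is a positive
  lower bound for the distance from \<open>x\<close> to \<open>K\<close>.\<close>

lemma separate_point_convex:
  fixes K :: "'a::real_normed_vector set"
  assumes K: "convex K" and x: "x \<notin> closure K"
  shows "\<exists>(\<psi> :: 'a \<Rightarrow>\<^sub>L real) b. (\<forall>k\<in>K. blinfun_apply \<psi> k \<le> b) \<and> b < blinfun_apply \<psi> x"
proof (cases "K = {}")
  case True
  then show ?thesis by (metis empty_iff lt_ex)
next
  case False
  obtain d where d: "d > 0" "\<And>k. k \<in> K \<Longrightarrow> d \<le> norm (x - k)"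
    using x by (metis closure_approachable dist_norm norm_minus_commute not_le)
  let ?I = "{0::real..} \<times> K"
  let ?g = "\<lambda>y (t, k). norm (y + t *\<^sub>R (x - k)) - t * d"
  define p where "p y = (INF i\<in>?I. ?g y i)" for y
  have I: "?I \<noteq> {}" using False by auto
  have lb: "- norm y \<le> norm (y + t *\<^sub>R (x - k)) - t * d" if "t \<ge> 0" "k \<in> K" for t y k
  proof -
    have "t * d \<le> norm (t *\<^sub>R (x - k))" using d that by (simp add: mult_left_mono)
    also have "\<dots> \<le> norm (y + t *\<^sub>R (x - k)) + norm y"
      using norm_triangle_ineq4[of "y + t *\<^sub>R (x - k)" y] by simp
    finally show ?thesis by simp
  qed
  have bdd: "bdd_below (?g y ` ?I)" for y
    by (rule bdd_belowI2[where m = "- norm y"]) (use lb in auto)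
  have p_le: "p y \<le> norm (y + t *\<^sub>R (x - k)) - t * d" if "t \<ge> 0" "k \<in> K" for y t k
    using cINF_lower[OF bdd, of "(t, k)" y] that by (simp add: p_def)
  have le_p: "b \<le> p y" if "\<And>t k. t \<ge> 0 \<Longrightarrow> k \<in> K \<Longrightarrow> b \<le> norm (y + t *\<^sub>R (x - k)) - t * d" for b y
    unfolding p_def by (rule cINF_greatest[OF I]) (use that in auto)
  have "p (y + z) \<le> p y + p z" for y z
  proof -
    have *: "p (y + z) \<le> (norm (y + s *\<^sub>R (x - k)) - s * d) + (norm (z + t *\<^sub>R (x - l)) - t * d)"
      if st: "s \<ge> 0" "t \<ge> 0" and kl: "k \<in> K" "l \<in> K" for s t k l
    proof (cases "s + t = 0")
      case True
      with st have "s = 0" "t = 0" by auto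
      then show ?thesis using p_le[of 0 k "y + z"] kl norm_triangle_ineq[of y z] by simp
    next
      case False
      \<comment> \<open>The competitors for \<open>y\<close> and \<open>z\<close> merge into one for
        \<open>y + z\<close> with parameter \<open>s + t\<close> and point \<open>m\<close>;
        convexity of \<open>K\<close> enters here.\<close>
      define m where "m = (s / (s + t)) *\<^sub>R k + (t / (s + t)) *\<^sub>R l"
      have "m \<in> K" unfolding m_def
        by (rule convexD[OF K kl]) (use False st in \<open>auto simp: add_divide_distrib[symmetric]\<close>)
      moreover have "(s + t) *\<^sub>R m = s *\<^sub>R k + t *\<^sub>R l"
        using False by (simp add: m_def scaleR_add_right)
      then have "(y + z) + (s + t) *\<^sub>R (x - m) = (y + s *\<^sub>R (x - k)) + (z + t *\<^sub>R (x - l))"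
        by (simp add: algebra_simps)
      ultimately show ?thesis
        using p_le[of "s + t" m "y + z"] st
          norm_triangle_ineq[of "y + s *\<^sub>R (x - k)" "z + t *\<^sub>R (x - l)"]
        by (simp add: algebra_simps)
    qed
    have "p (y + z) - (norm (y + s *\<^sub>R (x - k)) - s * d) \<le> p z" if "s \<ge> 0" "k \<in> K" for s k
      using *[of s _ k] that by (intro le_p) (simp add: algebra_simps)
    then have "p (y + z) - p z \<le> p y"
      by (intro le_p) (simp add: algebra_simps)
    then show ?thesis by simp
  qed
  moreover have "p (c *\<^sub>R y) \<le> c * p y" if c: "c > 0" for c y
  proof -
    have "p (c *\<^sub>R y) / c \<le> p y"
    proof (rule le_p)
      fix t :: real and k assume t: "t \<ge> 0" and k: "k \<in> K"
      have "p (c *\<^sub>R y) \<le> norm (c *\<^sub>R (y + t *\<^sub>R (x - k))) - (c * t) * d"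
        using p_le[of "c * t" k "c *\<^sub>R y"] t k c by (simp add: scaleR_add_right del: norm_scaleR)
      then have "p (c *\<^sub>R y) \<le> c * (norm (y + t *\<^sub>R (x - k)) - t * d)"
        using c by (simp only: norm_scaleR abs_of_pos right_diff_distrib mult.assoc)
      then show "p (c *\<^sub>R y) / c \<le> norm (y + t *\<^sub>R (x - k)) - t * d"
        using c by (simp only: pos_divide_le_eq mult.commute)
    qed
    then show ?thesis using c by (simp add: field_simps)
  qed
  ultimately have "sublinear p" by (simp add: sublinear_def)
  then obtain q where q: "linear q" "\<And>y. q y \<le> p y"
    using linear_below_sublinear by blast
  obtain k0 where k0: "k0 \<in> K" using False by auto
  have q_norm: "q y \<le> norm y" for y
    using p_le[of 0 k0 y] k0 q(2)[of y] by simp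
  have "bounded_linear q"
  proof (rule bounded_linear_intro)
    show "norm (q y) \<le> norm y * 1" for y
      using q_norm[of y] q_norm[of "- y"] by (simp add: linear_neg[OF q(1)])
  qed (simp_all add: linear_add[OF q(1)] linear_cmul[OF q(1)])
  then have B: "blinfun_apply (Blinfun q) = q" by (rule bounded_linear_Blinfun_apply)
  have "q k \<le> q x - d" if "k \<in> K" for k
    using q(2)[of "k - x"] p_le[of 1 k "k - x"] that by (simp add: linear_diff[OF q(1)])
  then show ?thesis
    using d(1) by (intro exI[of _ "Blinfun q"] exI[of _ "q x - d"]) (auto simp: B)
qed

section \<open>Closed convex hulls, half-spaces and diameters\<close>

lemma closure_convex_hull_minimal:
  fixes A :: "'a::real_normed_vector set"
  assumes "A \<subseteq> T" "closed T" "convex T"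
  shows "closure (convex hull A) \<subseteq> T"
  using assms by (intro closure_minimal hull_minimal)

lemma closure_convex_hull_le:
  fixes \<psi> :: "'a::real_normed_vector \<Rightarrow>\<^sub>L real"
  assumes "\<And>k. k \<in> K \<Longrightarrow> \<psi> k \<le> b" and "x \<in> closure (convex hull K)"
  shows "\<psi> x \<le> b"
proof -
  have "closed {x. \<psi> x \<le> b}"
    by (intro closed_Collect_le continuous_intros)
  moreover have "convex {x. \<psi> x \<le> b}"
    by (intro convexI)
      (auto simp: blinfun.add_right blinfun.scaleR_right intro: convex_bound_le)
  ultimately have "closure (convex hull K) \<subseteq> {x. \<psi> x \<le> b}"
    using assms(1) by (intro closure_convex_hull_minimal) auto
  then show ?thesis using assms(2) by auto
qed

lemma separate_point_closure_convex_hull: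
  fixes K :: "'a::real_normed_vector set"
  assumes "x \<notin> closure (convex hull K)"
  obtains \<psi> :: "'a \<Rightarrow>\<^sub>L real" and b where "\<And>k. k \<in> K \<Longrightarrow> \<psi> k \<le> b" "b < \<psi> x"
  using separate_point_convex[OF convex_convex_hull assms] by (metis hull_inc)

lemma diam_lessD:
  assumes "diam d S < ennreal e" "x \<in> S" "y \<in> S"
  shows "d x y < e"
proof -
  have "ennreal (d x y) \<le> diam d S"
    unfolding diam_def using assms by (meson SUP_upper2 SUP_upper)
  then have "ennreal (d x y) < ennreal e" using assms by simp
  then show ?thesis by (meson ennreal_leI not_le)
qed

lemma diam_lessI:
  assumes "\<And>x y. x \<in> S \<Longrightarrow> y \<in> S \<Longrightarrow> d x y \<le> e" "e < e'" "0 < e'"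
  shows "diam d S < ennreal e'"
proof -
  have "diam d S \<le> ennreal e"
    unfolding diam_def using assms by (intro SUP_least ennreal_leI)
  also have "\<dots> < ennreal e'" using assms by (simp add: ennreal_lessI)
  finally show ?thesis .
qed

lemma bdd_above_blinfun_image:
  fixes \<psi> :: "'a::real_normed_vector \<Rightarrow>\<^sub>L real"
  assumes "bounded A"
  shows "bdd_above (blinfun_apply \<psi> ` A)"
  by (intro bounded_imp_bdd_above bounded_linear_image[OF assms] blinfun.bounded_linear_right)

section \<open>A Lipschitz function on a set without small slices\<close>

text \<open>A slice on which \<open>\<psi>\<close> is within \<open>t\<close> of its supremum consists, up to an error
  proportional to \<open>t\<close>, of points of the removed ball: this is the closed convex condition
  defining \<open>T\<close> below.\<close>

lemma closure_convex_hull_Diff_balls: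
  fixes A :: "'a::real_normed_vector set"
  assumes A: "bounded A" and d: "d > 0" and F: "finite F"
    and big: "\<And>(\<psi> :: 'a \<Rightarrow>\<^sub>L real) b y. \<exists>x\<in>A. b < \<psi> x \<Longrightarrow> \<exists>x\<in>A. b < \<psi> x \<and> x \<notin> ball y (2 * d)"
  shows "A \<subseteq> closure (convex hull (A - (\<Union>y\<in>F. ball y d)))"
  using F
proof (induction F)
  case empty
  have "A \<subseteq> convex hull A" by (rule hull_subset)
  then show ?case using closure_subset by fastforce
next
  case (insert y F)
  let ?K = "A - (\<Union>y\<in>F. ball y d)" and ?K1 = "A - (\<Union>y\<in>insert y F. ball y d)"
  show ?case
  proof
    fix x0 assume x0: "x0 \<in> A"
    show "x0 \<in> closure (convex hull ?K1)"
    proof (rule ccontr)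
      assume "x0 \<notin> closure (convex hull ?K1)"
      then obtain \<psi> :: "'a \<Rightarrow>\<^sub>L real" and b
        where b: "\<And>k. k \<in> ?K1 \<Longrightarrow> \<psi> k \<le> b" "b < \<psi> x0"
        by (rule separate_point_closure_convex_hull) blast
      define M where "M = Sup (blinfun_apply \<psi> ` A)"
      have M: "\<psi> x \<le> M" if "x \<in> A" for x
        unfolding M_def using that bdd_above_blinfun_image[OF A] by (intro cSup_upper) auto
      have bM: "b < M" using M[OF x0] b(2) by simp
      obtain R where R: "R > 0" "\<And>x. x \<in> A \<Longrightarrow> norm (x - y) \<le> R"
      proof -
        have "bounded ((\<lambda>x. x - y) ` A)" using A by (rule bounded_translation_minus)
        then show thesis using that by (auto simp: bounded_pos)
      qed
      \<comment> \<open>The slope \<open>c\<close> makes a drop of \<open>M - b\<close> in \<psi>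
        worth \<open>R\<close>, so the points of \<open>?K1\<close>, where \<psi> is at most
        \<open>b\<close>, satisfy the inequality defining \<open>T\<close>.\<close>
      define c where "c = R / (M - b)"
      have c: "c > 0" "c * (M - b) = R" using R(1) bM by (auto simp: c_def)
      define T where "T = {x. norm (x - y) + c * \<psi> x \<le> d + c * M}"
      have "closed T" unfolding T_def by (intro closed_Collect_le continuous_intros)
      moreover have "convex T"
      proof (rule convexI)
        fix p q u v assume pq: "p \<in> T" "q \<in> T" and uv: "0 \<le> (u::real)" "0 \<le> v" "u + v = 1"
        have "(u *\<^sub>R p + v *\<^sub>R q) - y = u *\<^sub>R (p - y) + v *\<^sub>R (q - y)"
          using uv(3) by (simp add: algebra_simps flip: scaleR_add_left)
        then have "norm (u *\<^sub>R p + v *\<^sub>R q - y) \<le> u * norm (p - y) + v * norm (q - y)"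
          using norm_triangle_ineq[of "u *\<^sub>R (p - y)" "v *\<^sub>R (q - y)"] uv by simp
        moreover have "u * (norm (p - y) + c * \<psi> p) + v * (norm (q - y) + c * \<psi> q) \<le> d + c * M"
          using pq uv by (intro convex_bound_le) (auto simp: T_def)
        ultimately show "u *\<^sub>R p + v *\<^sub>R q \<in> T"
          by (simp add: T_def blinfun.add_right blinfun.scaleR_right algebra_simps)
      qed
      moreover have "?K \<subseteq> T"
      proof
        fix x assume x: "x \<in> ?K"
        show "x \<in> T"
        proof (cases "x \<in> ball y d")
          case True
          have "c * \<psi> x \<le> c * M" using c M x by (intro mult_left_mono) auto
          with True show ?thesis by (simp add: T_def dist_norm norm_minus_commute)
        next
          case False
          with x have "x \<in> ?K1" by auto
          then have "c * (M - b) \<le> c * (M - \<psi> x)" using c b(1) by (intro mult_left_mono) auto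
          then have "R \<le> c * M - c * \<psi> x" unfolding c(2) by (simp add: right_diff_distrib)
          with R(2)[of x] x d show ?thesis by (simp add: T_def)
        qed
      qed
      ultimately have "A \<subseteq> T"
        using insert.IH closure_convex_hull_minimal by blast
      \<comment> \<open>With \<open>c * t = d / 2\<close>, points of \<open>T\<close> whose value
        exceeds \<open>M - t\<close> lie within \<open>3 * d / 2\<close> of \<open>y\<close>; this
        is why \<open>big\<close> speaks of the radius \<open>2 * d\<close> while only balls of
        radius \<open>d\<close> are removed.\<close>
      define t where "t = d / (2 * c)"
      have t: "t > 0" "c * t = d / 2" using c d by (auto simp: t_def)
      have "\<exists>x\<in>A. M - t < \<psi> x"
        using less_cSup_iff[of "blinfun_apply \<psi> ` A" "M - t"] x0 t(1) bdd_above_blinfun_image[OF A]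
        unfolding M_def by auto
      then obtain x where x: "x \<in> A" "M - t < \<psi> x" "x \<notin> ball y (2 * d)"
        using big by blast
      have "c * (M - t) < c * \<psi> x" using x c by simp
      moreover have "norm (x - y) + c * \<psi> x \<le> d + c * M" using x \<open>A \<subseteq> T\<close> by (auto simp: T_def)
      ultimately have "norm (x - y) < d + d / 2" using t by (simp add: right_diff_distrib)
      with x(3) d show False by (simp add: dist_norm norm_minus_commute)
    qed
  qed
qed

section \<open>Separated sets with closed convex hulls containing each other\<close>

lemma convex_hull_finite_subset:
  assumes "z \<in> convex hull A"
  obtains S where "finite S" "S \<subseteq> A" "z \<in> convex hull S"
  using assms that unfolding convex_hull_explicit by blast

text \<open>Finite sets grow: the points added to \<open>F n\<close> keep distance \<open>d\<close>
  from \<open>F n\<close>, while their convex hull comes within \<open>1 / real (Suc n)\<close> of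
  each point of \<open>F n\<close>. Each layer approximates all earlier ones, so the layers of one
  parity alone recover everything in the closed hull.\<close>

lemma exists_separated_same_hull:
  fixes A :: "'a::real_normed_vector set"
  assumes ne: "A \<noteq> {}" and d: "d > 0"
    and dense: "\<And>F. finite F \<Longrightarrow> A \<subseteq> closure (convex hull (A - (\<Union>y\<in>F. ball y d)))"
  obtains B0 B1 where "B0 \<subseteq> A" "B1 \<subseteq> A" "B0 \<noteq> {}"
    "\<And>x y. x \<in> B0 \<Longrightarrow> y \<in> B1 \<Longrightarrow> d \<le> dist x y"
    "B0 \<union> B1 \<subseteq> closure (convex hull B0)" "B0 \<union> B1 \<subseteq> closure (convex hull B1)"
proof -
  let ?P = "\<lambda>F. finite F \<and> F \<subseteq> A \<and> F \<noteq> {}"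
  let ?Q = "\<lambda>n F G. F \<subseteq> G \<and> (\<forall>x\<in>F. \<exists>z \<in> convex hull (G - F). dist z x < 1 / real (Suc n)) \<and>
    (\<forall>x\<in>F. \<forall>y\<in>G - F. d \<le> dist x y)"
  have "\<exists>F. \<forall>n. ?P (F n) \<and> ?Q n (F n) (F (Suc n))"
  proof (rule dependent_nat_choice)
    obtain a where "a \<in> A" using ne by auto
    then show "\<exists>F. ?P F" by (intro exI[of _ "{a}"]) auto
  next
    fix F n assume F: "?P F"
    let ?K = "A - (\<Union>y\<in>F. ball y d)"
    have "\<exists>S. finite S \<and> S \<subseteq> ?K \<and> (\<exists>z\<in>convex hull S. dist z x < 1 / real (Suc n))" if x: "x \<in> F" for x
    proof -
      have "x \<in> closure (convex hull ?K)" using dense F x by blast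
      then obtain z where "z \<in> convex hull ?K" "dist z x < 1 / real (Suc n)"
        unfolding closure_approachable by (meson zero_less_divide_1_iff of_nat_0_less_iff zero_less_Suc)
      then show ?thesis by (meson convex_hull_finite_subset)
    qed
    then obtain S where S: "\<And>x. x \<in> F \<Longrightarrow> finite (S x)" "\<And>x. x \<in> F \<Longrightarrow> S x \<subseteq> ?K"
      "\<And>x. x \<in> F \<Longrightarrow> \<exists>z\<in>convex hull (S x). dist z x < 1 / real (Suc n)"
      by metis
    define G where "G = F \<union> (\<Union>x\<in>F. S x)"
    \<comment> \<open>Members of \<open>F\<close> are centres of removed balls, so the points of
      \<open>S x\<close> are new.\<close>
    have SG: "S x \<subseteq> G - F" if "x \<in> F" for x
    proof
      fix y assume y: "y \<in> S x"
      then have "y \<notin> F" using S(2)[OF that] d by force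
      then show "y \<in> G - F" using y that by (auto simp: G_def)
    qed
    have PG: "?P G" using F S(1) S(2) by (auto simp: G_def)
    have "F \<subseteq> G" by (simp add: G_def)
    moreover have "\<exists>z \<in> convex hull (G - F). dist z x < 1 / real (Suc n)" if "x \<in> F" for x
      using S(3)[OF that] hull_mono[OF SG[OF that], of convex] by blast
    moreover have "d \<le> dist x y" if xy: "x \<in> F" "y \<in> G - F" for x y
    proof -
      obtain x' where "x' \<in> F" "y \<in> S x'" using xy by (auto simp: G_def)
      then have "y \<in> ?K" using S(2) by blast
      then show ?thesis using xy(1) by (auto simp: not_less)
    qed
    ultimately have QG: "?Q n F G" by blast
    show "\<exists>G. ?P G \<and> ?Q n F G" by (rule exI[of _ G], rule conjI[OF PG QG])
  qed
  then obtain F where F0: "\<forall>n. ?P (F n) \<and> ?Q n (F n) (F (Suc n))" by (rule exE)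
  have F: "?P (F n)" "?Q n (F n) (F (Suc n))" for n
    by (rule conjunct1[OF spec[OF F0]], rule conjunct2[OF spec[OF F0]])
  define N where "N n = F (Suc n) - F n" for n
  define B where "B i = (\<Union>n. N (2 * n + i))" for i
  have mono: "F m \<subseteq> F n" if "m \<le> n" for m n
    using lift_Suc_mono_le[of F, OF _ that] F(2) by blast
  have NA: "N n \<subseteq> A" for n using F(1)[of "Suc n"] by (auto simp: N_def)
  have dist: "d \<le> dist x y" if "x \<in> N m" "y \<in> N n" "m < n" for x y m n
  proof -
    have "x \<in> F n" using that mono[of "Suc m" n] by (auto simp: N_def)
    then show ?thesis using F(2)[of n] that(2) by (auto simp: N_def)
  qed
  have approx: "F m \<subseteq> closure (convex hull (B i))" for m i
  proof
    fix x assume x: "x \<in> F m"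
    show "x \<in> closure (convex hull (B i))" unfolding closure_approachable
    proof (intro allI impI)
      fix e :: real assume "e > 0"
      then obtain k where k: "inverse (real (Suc k)) < e" using reals_Archimedean by blast
      \<comment> \<open>This index is at least \<open>m\<close>, so \<open>x\<close> is in
        \<open>F n\<close>; at least \<open>k\<close>, so the error is below \<open>e\<close>; and
        it indexes a layer of \<open>B i\<close>.\<close>
      define n where "n = 2 * (k + m) + i"
      have "x \<in> F n" using x mono[of m n] by (auto simp: n_def)
      then obtain z where z: "z \<in> convex hull (N n)" "dist z x < 1 / real (Suc n)"
        using F(2)[of n] by (auto simp: N_def)
      have "1 / real (Suc n) \<le> inverse (real (Suc k))"
        by (simp add: n_def field_simps)
      moreover have "N n \<subseteq> B i" unfolding B_def n_def by blast
      ultimately show "\<exists>z\<in>convex hull (B i). dist z x < e"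
        using z k hull_mono[of "N n" "B i" convex] by (intro bexI[of _ z]) auto
    qed
  qed
  have B_sub: "B j \<subseteq> closure (convex hull (B i))" for i j
    using approx unfolding B_def N_def by blast
  have BA: "B i \<subseteq> A" for i
    using NA unfolding B_def by blast
  show thesis
  proof (rule that[of "B 0" "B 1"])
    show "B 0 \<subseteq> A" "B 1 \<subseteq> A" by (rule BA)+
    obtain x where "x \<in> F 0" using F(1)[of 0] by blast
    then have "x \<in> closure (convex hull (B 0))" using approx by blast
    then show "B 0 \<noteq> {}" by auto
    show "B 0 \<union> B 1 \<subseteq> closure (convex hull (B 0))" "B 0 \<union> B 1 \<subseteq> closure (convex hull (B 1))"
      by (intro Un_least B_sub)+
    fix x y assume "x \<in> B 0" "y \<in> B 1"
    then obtain m n where "x \<in> N (2 * m + 0)" "y \<in> N (2 * n + 1)" unfolding B_def by blast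
    then have mn: "x \<in> N (2 * m)" "y \<in> N (2 * n + 1)" by simp_all
    show "d \<le> dist x y"
    proof (cases "2 * m < 2 * n + 1")
      case True
      then show ?thesis using dist mn by blast
    next
      case False
      then have "2 * n + 1 < 2 * m" by presburger
      then show ?thesis using dist[OF mn(2,1)] by (simp add: dist_commute)
    qed
  qed
qed

text \<open>The distance to \<open>B0\<close> vanishes on \<open>B0\<close> and is at least
  \<open>d\<close> on \<open>B1\<close>, and every half-space meeting \<open>B0 \<union> B1\<close>
  meets both sets. So this function oscillates by at least \<open>d\<close> on each slice of the
  union.\<close>

lemma radon_nikodym_property_if_lipschitz_dentable:
  fixes C :: "'a::real_normed_vector set"
  assumes lip: "\<And>f :: 'a \<Rightarrow> real. 1-lipschitz_on C f \<Longrightarrow> dentable_on C dist f"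
  shows "radon_nikodym_property C"
  unfolding radon_nikodym_property_def dentable_on_def
proof (intro allI impI, elim conjE)
  fix A and e :: real
  assume A: "A \<subseteq> C" "A \<noteq> {}" "bounded A" and e: "e > 0"
  show "\<exists>H. open_halfspace H \<and> A \<inter> H \<noteq> {} \<and> diam dist ((\<lambda>x. x) ` (A \<inter> H)) < ennreal e"
  proof (rule ccontr)
    assume no: "\<not> ?thesis"
    \<comment> \<open>A ball of radius \<open>2 * d\<close> then has diameter at most
      \<open>e / 2\<close>, so no slice of \<open>A\<close> fits into one.\<close>
    define d where "d = e / 8"
    have d: "d > 0" using e by (simp add: d_def)
    have big: "\<exists>x\<in>A. b < \<psi> x \<and> x \<notin> ball y (2 * d)" if "\<exists>x\<in>A. b < \<psi> x"
      for \<psi> :: "'a \<Rightarrow>\<^sub>L real" and b y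
    proof (rule ccontr)
      assume "\<not> ?thesis"
      then have sub: "A \<inter> {x. b < \<psi> x} \<subseteq> ball y (2 * d)" by auto
      have "diam dist ((\<lambda>x. x) ` (A \<inter> {x. b < \<psi> x})) < ennreal e"
      proof (rule diam_lessI)
        fix p q assume "p \<in> (\<lambda>x. x) ` (A \<inter> {x. b < \<psi> x})" "q \<in> (\<lambda>x. x) ` (A \<inter> {x. b < \<psi> x})"
        then have "dist y p < 2 * d" "dist y q < 2 * d" using sub by auto
        then show "dist p q \<le> 4 * d" using dist_triangle3[of p q y] by simp
      qed (use e in \<open>auto simp: d_def\<close>)
      moreover have "open_halfspace {x. b < \<psi> x}" by (auto simp: open_halfspace_def)
      ultimately show False using no that by blast
    qed
    obtain B0 B1 where B: "B0 \<subseteq> A" "B1 \<subseteq> A" "B0 \<noteq> {}"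
      and sep: "\<And>x y. x \<in> B0 \<Longrightarrow> y \<in> B1 \<Longrightarrow> d \<le> dist x y"
      and hull: "B0 \<union> B1 \<subseteq> closure (convex hull B0)" "B0 \<union> B1 \<subseteq> closure (convex hull B1)"
      using exists_separated_same_hull[OF A(2) d closure_convex_hull_Diff_balls[OF A(3) d _ big]]
      by metis
    define f where "f x = infdist x B0" for x
    have "1-lipschitz_on C f"
      by (rule lipschitz_onI) (auto simp: f_def dist_real_def infdist_triangle_abs)
    then have "dentable_on C dist f" by (rule lip)
    moreover have "B0 \<union> B1 \<subseteq> C" "B0 \<union> B1 \<noteq> {}" "bounded (B0 \<union> B1)"
      using A B bounded_subset[OF A(3), of "B0 \<union> B1"] by auto
    ultimately have "\<exists>H. open_halfspace H \<and> (B0 \<union> B1) \<inter> H \<noteq> {} \<and>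
        diam dist (f ` ((B0 \<union> B1) \<inter> H)) < ennreal d"
      using d unfolding dentable_on_def by simp
    then obtain H where H: "open_halfspace H" "(B0 \<union> B1) \<inter> H \<noteq> {}"
      "diam dist (f ` ((B0 \<union> B1) \<inter> H)) < ennreal d"
      by blast
    obtain \<psi> :: "'a \<Rightarrow>\<^sub>L real" and b where Hb: "H = {x. b < \<psi> x}"
      using H(1) by (auto simp: open_halfspace_def)
    obtain x where x: "x \<in> B0 \<union> B1" "b < \<psi> x" using H(2) Hb by blast
    \<comment> \<open>A functional bounded by \<open>b\<close> on \<open>K\<close> is bounded by
      \<open>b\<close> on its closed hull, in particular at \<open>x\<close>.\<close>
    have meet: "\<exists>y\<in>K. b < \<psi> y" if "B0 \<union> B1 \<subseteq> closure (convex hull K)" for K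
      using closure_convex_hull_le[of K \<psi> b x] that x by force
    obtain p q where pq: "p \<in> B0" "b < \<psi> p" "q \<in> B1" "b < \<psi> q"
      using meet[OF hull(1)] meet[OF hull(2)] by blast
    have "dist (f p) (f q) < d"
      using H(3) by (rule diam_lessD) (use pq Hb in auto)
    moreover have "f p = 0" using pq by (simp add: f_def)
    moreover have "d \<le> f q"
      unfolding f_def infdist_notempty[OF B(3)]
      using B(3) sep pq(3) by (intro cINF_greatest) (auto simp: dist_commute)
    ultimately show False by (simp add: dist_real_def)
  qed
qed

section \<open>Killed random walks\<close>

text \<open>At time \<open>n\<close> the walk moves from \<open>x\<close> to \<open>y\<close> with probability \<open>p n x y\<close>; the missing
  probability is that of being killed. Killed mass sits somewhere in the ball of radius \<open>R\<close>,
  which is where the term \<open>R * (1 - \<Sum>y. p n x y)\<close> comes from.\<close>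

locale killed_walk =
  fixes Q :: "nat \<Rightarrow> 'a::banach \<Rightarrow> 'a set" and p :: "nat \<Rightarrow> 'a \<Rightarrow> 'a \<Rightarrow> real"
    and S :: "'a set" and R e :: real
  assumes finite_Q: "x \<in> S \<Longrightarrow> finite (Q n x)"
    and Q_sub: "x \<in> S \<Longrightarrow> y \<in> Q n x \<Longrightarrow> y \<in> S"
    and p_nonneg: "x \<in> S \<Longrightarrow> y \<in> Q n x \<Longrightarrow> 0 \<le> p n x y"
    and sum_p: "x \<in> S \<Longrightarrow> (\<Sum>y\<in>Q n x. p n x y) \<le> 1"
    and norm_le_R: "x \<in> S \<Longrightarrow> norm x \<le> R"
    and e_nonneg: "0 \<le> e"
    and err: "x \<in> S \<Longrightarrow>
      norm ((\<Sum>y\<in>Q n x. p n x y *\<^sub>R y) - x) \<le> R * (1 - (\<Sum>y\<in>Q n x. p n x y)) + e / 2 ^ n"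
begin

text \<open>The transition operator on functions of time and position, with killed paths
  contributing \<open>0\<close>. Its fixed points are the space-time harmonic functions, that is,
  the martingales of the walk.\<close>

definition step :: "(nat \<Rightarrow> 'a \<Rightarrow> 'b::real_normed_vector) \<Rightarrow> nat \<Rightarrow> 'a \<Rightarrow> 'b" where
  "step f n x = (\<Sum>y\<in>Q n x. p n x y *\<^sub>R f (Suc n) y)"

text \<open>The expectation of \<open>f\<close> at time \<open>n + k\<close> for the walk started at
  \<open>x\<close> at time \<open>n\<close>, over the paths not yet killed.\<close>

primrec W :: "nat \<Rightarrow> (nat \<Rightarrow> 'a \<Rightarrow> 'b::real_normed_vector) \<Rightarrow> nat \<Rightarrow> 'a \<Rightarrow> 'b" where
  "W 0 f = f"
| "W (Suc k) f = step (W k f)"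

lemma step_mono:
  fixes f g :: "nat \<Rightarrow> 'a \<Rightarrow> real"
  assumes "\<And>y. y \<in> S \<Longrightarrow> f (Suc n) y \<le> g (Suc n) y" "x \<in> S"
  shows "step f n x \<le> step g n x"
  unfolding step_def using assms Q_sub p_nonneg
  by (intro sum_mono) (auto intro: mult_left_mono)

text \<open>Only values at time \<open>n + k\<close> are involved, so a negative
  \<open>W k f n x\<close> exhibits a state of that time where \<open>f\<close> is negative.\<close>

lemma W_nonneg:
  fixes f :: "nat \<Rightarrow> 'a \<Rightarrow> real"
  assumes "\<And>y. y \<in> S \<Longrightarrow> 0 \<le> f (n + k) y" "x \<in> S"
  shows "0 \<le> W k f n x"
  using assms
proof (induction k arbitrary: n x)
  case (Suc k)
  have "0 \<le> W k f (Suc n) y" if "y \<in> S" for y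
    using Suc.prems that by (intro Suc.IH) auto
  then show ?case
    using Suc.prems Q_sub p_nonneg by (auto simp: step_def intro!: sum_nonneg)
qed auto

lemma W_lincomb:
  "W k (\<lambda>n x. f n x + c *\<^sub>R g n x) n x = W k f n x + c *\<^sub>R W k g n x"
proof (induction k arbitrary: n x)
  case (Suc k)
  then show ?case
    by (simp add: step_def scaleR_add_right sum.distrib scaleR_sum_right mult.commute)
qed auto

lemma W_blinfun:
  fixes \<psi> :: "'b::real_normed_vector \<Rightarrow>\<^sub>L real"
  shows "\<psi> (W k f n x) = W k (\<lambda>n x. \<psi> (f n x)) n x"
  by (induction k arbitrary: n x) (auto simp: step_def blinfun.sum_right blinfun.scaleR_right)

lemma W_invariant:
  assumes "\<And>n x. x \<in> S \<Longrightarrow> step f n x = f n x" "x \<in> S"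
  shows "W k f n x = f n x"
  using assms(2)
proof (induction k arbitrary: n x)
  case (Suc k)
  have "W (Suc k) f n x = step f n x"
    unfolding W.simps step_def using Suc Q_sub by (intro sum.cong) auto
  then show ?case using assms(1) Suc.prems by simp
qed auto

text \<open>\<open>bary k n x\<close> is not normalised: the barycentre after \<open>k\<close> steps of the mass alive
  by then, times that mass.\<close>

definition alive :: "nat \<Rightarrow> nat \<Rightarrow> 'a \<Rightarrow> real" where
  "alive k = W k (\<lambda>_ _. 1)"

definition bary :: "nat \<Rightarrow> nat \<Rightarrow> 'a \<Rightarrow> 'a" where
  "bary k = W k (\<lambda>_ x. x)"

text \<open>The probability of never being killed. Convergence on \<open>S\<close> is monotone, by
  \<open>alive_tendsto\<close>.\<close>

definition surv :: "nat \<Rightarrow> 'a \<Rightarrow> real" where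
  "surv n x = lim (\<lambda>k. alive k n x)"

text \<open>A vector-valued harmonic function. Like \<open>bary\<close> it is not normalised: for
  positive \<open>surv n x\<close> it is \<open>surv n x\<close> times a barycentre.\<close>

definition lbary :: "nat \<Rightarrow> 'a \<Rightarrow> 'a" where
  "lbary n x = lim (\<lambda>k. bary k n x)"

lemma alive_0 [simp]: "alive 0 n x = 1" and alive_Suc: "alive (Suc k) = step (alive k)"
  and bary_0 [simp]: "bary 0 n x = x" and bary_Suc: "bary (Suc k) = step (bary k)"
  by (auto simp: alive_def bary_def)

lemma alive_nonneg: "x \<in> S \<Longrightarrow> 0 \<le> alive k n x"
  unfolding alive_def by (rule W_nonneg) auto

lemma alive_Suc_le: "x \<in> S \<Longrightarrow> alive (Suc k) n x \<le> alive k n x"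
proof (induction k arbitrary: n x)
  case 0
  then show ?case using sum_p by (simp add: alive_Suc step_def)
next
  case (Suc k)
  then show ?case unfolding alive_Suc[of "Suc k"] alive_Suc[of k] 
    by (intro step_mono) (auto simp flip: alive_Suc)
qed

lemma alive_decseq: "x \<in> S \<Longrightarrow> decseq (\<lambda>k. alive k n x)"
  by (intro decseq_SucI alive_Suc_le)

lemma alive_le_1: "x \<in> S \<Longrightarrow> alive k n x \<le> 1"
  using decseqD[OF alive_decseq, of x 0 k n] by simp

lemma alive_tendsto: "x \<in> S \<Longrightarrow> (\<lambda>k. alive k n x) \<longlonglongrightarrow> surv n x"
proof -
  assume x: "x \<in> S"
  obtain L where "(\<lambda>k. alive k n x) \<longlonglongrightarrow> L"
    using decseq_convergent[OF alive_decseq[OF x]] alive_nonneg[OF x] by metis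
  then show ?thesis unfolding surv_def by (simp add: limI)
qed

lemma surv_nonneg: "x \<in> S \<Longrightarrow> 0 \<le> surv n x"
  by (rule LIMSEQ_le_const[OF alive_tendsto]) (auto intro: alive_nonneg)

lemma surv_le_1: "x \<in> S \<Longrightarrow> surv n x \<le> 1"
  by (rule LIMSEQ_le_const2[OF alive_tendsto]) (auto intro: alive_le_1)

lemma step_tendsto:
  assumes "\<And>y. y \<in> S \<Longrightarrow> (\<lambda>k. f k (Suc n) y) \<longlonglongrightarrow> g (Suc n) y" "x \<in> S"
  shows "(\<lambda>k. step (f k) n x) \<longlonglongrightarrow> step g n x"
  unfolding step_def using assms Q_sub by (intro tendsto_intros) auto

lemma step_surv: "x \<in> S \<Longrightarrow> step surv n x = surv n x"
proof -
  assume x: "x \<in> S"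
  have "(\<lambda>k. alive (Suc k) n x) \<longlonglongrightarrow> step surv n x"
    unfolding alive_Suc by (rule step_tendsto[OF alive_tendsto x])
  then show ?thesis
    using LIMSEQ_unique LIMSEQ_Suc[OF alive_tendsto[OF x]] by blast
qed

text \<open>The bound \<open>err\<close>, at time \<open>n + k\<close>, averaged over the walk: the
  mass killed in that step costs \<open>R\<close> times itself, and the other error is weighted by a
  total mass of at most \<open>1\<close>.\<close>

lemma step_bary_dist:
  assumes "x \<in> S"
  shows "norm (bary (Suc k) n x - bary k n x) \<le> R * (alive k n x - alive (Suc k) n x) + e / 2 ^ (n + k)"
  using assms
proof (induction k arbitrary: n x)
  case 0
  then show ?case using err[of x n] by (simp add: bary_Suc alive_Suc step_def)
next
  case (Suc k)
  have p1: "(\<Sum>y\<in>Q n x. p n x y) \<le> 1" using sum_p Suc.prems .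
  have "norm (bary (Suc (Suc k)) n x - bary (Suc k) n x)
      = norm (\<Sum>y\<in>Q n x. p n x y *\<^sub>R (bary (Suc k) (Suc n) y - bary k (Suc n) y))"
    unfolding bary_Suc[of "Suc k"] bary_Suc[of k] step_def
    by (simp add: sum_subtractf scaleR_diff_right)
  also have "\<dots> \<le> (\<Sum>y\<in>Q n x. p n x y *
      (R * (alive k (Suc n) y - alive (Suc k) (Suc n) y) + e / 2 ^ (Suc n + k)))"
  proof (rule sum_norm_le)
    fix y assume y: "y \<in> Q n x"
    show "norm (p n x y *\<^sub>R (bary (Suc k) (Suc n) y - bary k (Suc n) y))
      \<le> p n x y * (R * (alive k (Suc n) y - alive (Suc k) (Suc n) y) + e / 2 ^ (Suc n + k))"
      using p_nonneg[OF Suc.prems y] Suc.IH[OF Q_sub[OF Suc.prems y], of "Suc n"]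
      by (simp del: bary_0 add: mult_left_mono)
  qed
  also have "\<dots> = R * (alive (Suc k) n x - alive (Suc (Suc k)) n x)
      + (e / 2 ^ (n + Suc k)) * (\<Sum>y\<in>Q n x. p n x y)"
    unfolding alive_Suc[of "Suc k"] alive_Suc[of k] step_def
    by (simp add: distrib_left right_diff_distrib sum.distrib sum_subtractf sum_distrib_left
        sum_distrib_right mult.left_commute mult.commute flip: sum_divide_distrib)
  also have "\<dots> \<le> R * (alive (Suc k) n x - alive (Suc (Suc k)) n x) + e / 2 ^ (n + Suc k)"
    using mult_left_mono[OF p1, of "e / 2 ^ (n + Suc k)"] e_nonneg by simp
  finally show ?case .
qed

text \<open>The bound is a difference of two values of one sequence, so that it telescopes; the
  factor \<open>2\<close> makes consecutive terms \<open>2 * e / 2 ^ (n + k)\<close> differ by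
  \<open>e / 2 ^ (n + k)\<close>. As that sequence converges, \<open>bary\<close> is Cauchy.\<close>

lemma bary_dist:
  assumes "x \<in> S"
  shows "norm (bary (k + i) n x - bary k n x)
    \<le> (R * alive k n x + 2 * e / 2 ^ (n + k)) - (R * alive (k + i) n x + 2 * e / 2 ^ (n + (k + i)))"
proof (induction i)
  case (Suc i)
  have "norm (bary (k + Suc i) n x - bary k n x)
    \<le> norm (bary (Suc (k + i)) n x - bary (k + i) n x) + norm (bary (k + i) n x - bary k n x)"
    using norm_triangle_ineq[of "bary (Suc (k + i)) n x - bary (k + i) n x"
        "bary (k + i) n x - bary k n x"] by simp
  moreover have "2 * e / 2 ^ (n + (k + Suc i)) = e / 2 ^ (n + (k + i))" by simp
  ultimately show ?case
    using Suc step_bary_dist[OF assms, of "k + i" n] by (simp add: right_diff_distrib)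
qed simp

lemma bary_tendsto:
  assumes "x \<in> S"
  shows "(\<lambda>k. bary k n x) \<longlonglongrightarrow> lbary n x"
proof -
  define t where "t k = R * alive k n x + 2 * e / 2 ^ (n + k)" for k
  have "(\<lambda>k. 2 * e / 2 ^ n * (1 / 2) ^ k) \<longlonglongrightarrow> 2 * e / 2 ^ n * 0"
    by (intro tendsto_intros) auto
  then have "(\<lambda>k. 2 * e / 2 ^ (n + k)) \<longlonglongrightarrow> 0"
    by (simp add: power_add power_one_over)
  then have "t \<longlonglongrightarrow> R * surv n x + 0"
    unfolding t_def by (intro tendsto_intros alive_tendsto assms)
  then have "Cauchy t" by (rule LIMSEQ_imp_Cauchy)
  have "Cauchy (\<lambda>k. bary k n x)"
  proof (rule metric_CauchyI)
    fix r :: real assume "r > 0"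
    then obtain N where N: "\<And>i j. i \<ge> N \<Longrightarrow> j \<ge> N \<Longrightarrow> dist (t i) (t j) < r"
      using metric_CauchyD[OF \<open>Cauchy t\<close>] by blast
    have *: "dist (bary i n x) (bary j n x) < r" if "N \<le> i" "i \<le> j" for i j
      using bary_dist[OF assms, of i "j - i" n] N[of i j] that
      by (simp add: t_def dist_norm norm_minus_commute)
    show "\<exists>M. \<forall>i\<ge>M. \<forall>j\<ge>M. dist (bary i n x) (bary j n x) < r"
      by (rule exI[of _ N]) (metis * dist_commute linear)
  qed
  then show ?thesis
    unfolding lbary_def by (simp add: Cauchy_convergent_iff convergent_LIMSEQ_iff)
qed

lemma step_lbary: "x \<in> S \<Longrightarrow> step lbary n x = lbary n x"
proof -
  assume x: "x \<in> S"
  have "(\<lambda>k. bary (Suc k) n x) \<longlonglongrightarrow> step lbary n x"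
    unfolding bary_Suc by (rule step_tendsto[OF bary_tendsto x])
  then show ?thesis
    using LIMSEQ_unique LIMSEQ_Suc[OF bary_tendsto[OF x]] by blast
qed

lemma R_nonneg: "x \<in> S \<Longrightarrow> 0 \<le> R"
  using norm_le_R[of x] norm_ge_zero[of x] by linarith

lemma lbary_dist:
  assumes "x \<in> S"
  shows "norm (lbary n x - x) \<le> R * (1 - surv n x) + 2 * e"
proof (rule LIMSEQ_le)
  show "(\<lambda>k. norm (bary k n x - x)) \<longlonglongrightarrow> norm (lbary n x - x)"
    by (intro tendsto_intros bary_tendsto assms)
  show "(\<lambda>k. R * (1 - alive k n x) + 2 * e) \<longlonglongrightarrow> R * (1 - surv n x) + 2 * e"
    by (intro tendsto_intros alive_tendsto assms)
  have "2 * e / 2 ^ n \<le> 2 * e" using divide_left_mono[of 1 "2 ^ n" "2 * e"] e_nonneg by simp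
  moreover have "0 \<le> 2 * e / 2 ^ (n + k)" for k using e_nonneg by simp
  ultimately have "norm (bary k n x - x) \<le> R * (1 - alive k n x) + 2 * e" for k
    using bary_dist[OF assms, of 0 k n] by (simp add: right_diff_distrib) (smt (verit))
  then show "\<exists>N. \<forall>k\<ge>N. norm (bary k n x - x) \<le> R * (1 - alive k n x) + 2 * e" by blast
qed

text \<open>Positivity of \<open>W\<close> applied to \<open>b - \<psi>\<close>. Not dividing by
  \<open>surv n x\<close> keeps the bound meaningful where this is \<open>0\<close>.\<close>

lemma blinfun_lbary_le:
  fixes \<psi> :: "'a \<Rightarrow>\<^sub>L real"
  assumes "\<And>y. y \<in> S \<Longrightarrow> \<psi> y \<le> b" "x \<in> S"
  shows "\<psi> (lbary n x) \<le> b * surv n x"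
proof (rule LIMSEQ_le)
  show "(\<lambda>k. \<psi> (bary k n x)) \<longlonglongrightarrow> \<psi> (lbary n x)"
    by (intro tendsto_intros bary_tendsto assms)
  show "(\<lambda>k. b * alive k n x) \<longlonglongrightarrow> b * surv n x"
    by (intro tendsto_intros alive_tendsto assms)
  have "0 \<le> W k (\<lambda>_ y. - \<psi> y + b *\<^sub>R 1) n x" for k
    using assms by (intro W_nonneg) auto
  also have "W k (\<lambda>_ y. - \<psi> y + b *\<^sub>R 1) n x = - \<psi> (bary k n x) + b * alive k n x" for k
    using W_lincomb[of k "\<lambda>_ y. - \<psi> y" b "\<lambda>_ _. 1::real" n x]
      W_blinfun[of "- \<psi>" k "\<lambda>_ y. y" n x]
    by (simp add: bary_def alive_def blinfun.minus_left)
  finally show "\<exists>N. \<forall>k\<ge>N. \<psi> (bary k n x) \<le> b * alive k n x" by auto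
qed

section \<open>Barycentres of the walk conditioned on survival\<close>

definition condbary :: "nat \<Rightarrow> 'a \<Rightarrow> 'a" where
  "condbary n x = lbary n x /\<^sub>R surv n x"

text \<open>Positive survival excludes the default value \<open>0\<close> that
  \<open>condbary\<close> takes when \<open>surv n x\<close> is \<open>0\<close>.\<close>

definition condbarys :: "'a set" where
  "condbarys = {condbary n x |n x. x \<in> S \<and> 0 < surv n x}"

text \<open>By \<open>blinfun_lbary_le\<close> a functional bounded by \<open>b\<close> on
  \<open>S\<close> is bounded by \<open>b\<close> after normalisation, so no functional can separate
  a conditioned barycentre from \<open>S\<close>.\<close>

lemma condbarys_subset: "condbarys \<subseteq> closure (convex hull S)"
proof
  fix z assume "z \<in> condbarys"
  then obtain n x where z: "z = condbary n x" "x \<in> S" "0 < surv n x"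
    by (auto simp: condbarys_def)
  show "z \<in> closure (convex hull S)"
  proof (rule ccontr)
    assume "z \<notin> closure (convex hull S)"
    then obtain \<psi> :: "'a \<Rightarrow>\<^sub>L real" and b where b: "\<And>k. k \<in> S \<Longrightarrow> \<psi> k \<le> b" "b < \<psi> z"
      by (rule separate_point_closure_convex_hull) blast
    have "\<psi> z \<le> b"
      using blinfun_lbary_le[of \<psi> b x n] b(1) z
      by (simp add: condbary_def blinfun.scaleR_right field_simps)
    with b(2) show False by simp
  qed
qed

text \<open>Before normalisation the displacement comes from \<open>lbary_dist\<close> and from the
  missing mass at \<open>x\<close>, whose norm is at most \<open>R\<close>. As
  \<open>surv n x\<close> exceeds \<open>1 / 2\<close>, normalising costs at most a factor
  \<open>2\<close>.\<close>

lemma condbary_dist: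
  assumes "x \<in> S" "1 - surv n x < c" "c \<le> 1 / 2"
  shows "norm (condbary n x - x) \<le> 4 * R * c + 4 * e"
proof -
  have s: "surv n x > 1 / 2" using assms by simp
  have "norm (surv n x *\<^sub>R (condbary n x - x)) = norm ((lbary n x - x) + (1 - surv n x) *\<^sub>R x)"
    using s by (simp add: condbary_def algebra_simps)
  also have "\<dots> \<le> norm (lbary n x - x) + (1 - surv n x) * norm x"
    using norm_triangle_ineq[of "lbary n x - x" "(1 - surv n x) *\<^sub>R x"] surv_le_1[OF assms(1), of n]
    by simp
  also have "\<dots> \<le> R * (1 - surv n x) + 2 * e + (1 - surv n x) * R"
    using lbary_dist[OF assms(1), of n] norm_le_R[OF assms(1)] surv_le_1[OF assms(1), of n]
    by (intro add_mono mult_left_mono) auto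
  also have "\<dots> \<le> 2 * R * c + 2 * e"
    using mult_left_mono[of "1 - surv n x" c R] assms(2) R_nonneg[OF assms(1)]
    by (simp add: algebra_simps)
  finally have "surv n x * norm (condbary n x - x) \<le> 2 * R * c + 2 * e" using s by simp
  moreover have "1 / 2 * norm (condbary n x - x) \<le> surv n x * norm (condbary n x - x)"
    using s by (intro mult_right_mono) auto
  ultimately show ?thesis by simp
qed

text \<open>Up to a summable error \<open>h\<close> is a submartingale for the walk, with value
  \<open>0\<close> once killed. As \<open>h\<close> is at most \<open>g\<close>, a large initial
  value needs surviving mass to carry it.\<close>

lemma surv_lower:
  fixes h :: "'a \<Rightarrow> real"
  assumes h: "\<And>n x. x \<in> S \<Longrightarrow> h x \<le> step (\<lambda>_. h) n x + c * (e / 2 ^ n)"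
    and g: "\<And>x. x \<in> S \<Longrightarrow> h x \<le> g" and x: "x \<in> S" and c: "c \<ge> 0"
  shows "h x \<le> g * surv n x + 2 * c * (e / 2 ^ n)"
proof -
  have W: "h x \<le> W k (\<lambda>_. h) n x + 2 * c * (e / 2 ^ n)" if "x \<in> S" for k n x
    using that
  proof (induction k arbitrary: n x)
    case 0
    then show ?case using c e_nonneg by simp
  next
    case (Suc k)
    \<comment> \<open>Because the errors halve, \<open>K\<close> is both the defect of the step at
      time \<open>n\<close> and the total error allowed from time \<open>Suc n\<close> on.\<close>
    define K where "K = c * (e / 2 ^ n)"
    have K: "0 \<le> K" "2 * c * (e / 2 ^ Suc n) = K" using c e_nonneg by (auto simp: K_def)
    have "h x \<le> step (\<lambda>_. h) n x + K" using h Suc.prems unfolding K_def .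
    also have "step (\<lambda>_. h) n x \<le> step (\<lambda>n x. W k (\<lambda>_. h) n x + K) n x"
      using Suc.IH[of _ "Suc n", unfolded K(2)] Suc.prems by (rule step_mono)
    also have "\<dots> = W (Suc k) (\<lambda>_. h) n x + (\<Sum>y\<in>Q n x. p n x y) * K"
      by (simp add: step_def distrib_left sum.distrib sum_distrib_right)
    also have "\<dots> \<le> W (Suc k) (\<lambda>_. h) n x + K"
      using mult_right_mono[OF sum_p[OF Suc.prems, of n] K(1)] by simp
    finally have "h x \<le> W (Suc k) (\<lambda>_. h) n x + 2 * K" by simp
    then show ?case by (simp add: K_def)
  qed
  have "h x \<le> g * alive k n x + 2 * c * (e / 2 ^ n)" for k
  proof -
    have "0 \<le> W k (\<lambda>_ y. g + (-1) *\<^sub>R h y) n x"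
      using g x by (intro W_nonneg) auto
    also have "\<dots> = W k (\<lambda>_ _. 0 + g *\<^sub>R 1) n x - W k (\<lambda>_. h) n x"
      using W_lincomb[of k "\<lambda>_ _. g" "-1" "\<lambda>_. h" n x] by simp
    also have "W k (\<lambda>_ _. 0 + g *\<^sub>R 1) n x = g * alive k n x"
      using W_lincomb[of k "\<lambda>_ _. 0::real" g "\<lambda>_ _. 1" n x] W_invariant[of "\<lambda>_ _. 0::real" x k n] x
      by (simp add: alive_def step_def)
    finally show ?thesis using W[OF x, of k n] by linarith
  qed
  moreover have "(\<lambda>k. g * alive k n x + 2 * c * (e / 2 ^ n)) \<longlonglongrightarrow> g * surv n x + 2 * c * (e / 2 ^ n)"
    by (intro tendsto_intros alive_tendsto x)
  ultimately show ?thesis by (intro LIMSEQ_le_const) auto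
qed

text \<open>A substitute for the martingale convergence theorem: as the total mass of the states with a small
  survival probability tends to \<open>0\<close>, some state, and then one of its successors, survives
  almost surely while keeping \<open>u\<close> small.\<close>

lemma good_successor:
  assumes u: "\<And>n y. y \<in> S \<Longrightarrow> 0 \<le> u n y" "\<And>n y. y \<in> S \<Longrightarrow> step u n y = u n y"
    and x: "x \<in> S" "u n x < c * surv n x" and c: "c > 0" "c \<le> 1 / 2"
  obtains m y y' where "y \<in> S" "y' \<in> Q m y" "u m y + (1 - surv m y) < 2 * c"
    "u (Suc m) y' + (1 - surv (Suc m) y') < 2 * c"
proof -
  \<comment> \<open>As \<open>u\<close> and \<open>surv\<close> are harmonic,
    \<open>W k f n x\<close> tends to \<open>u n x - c * surv n x\<close>, which is negative. A
    state with negative \<open>f\<close> has \<open>u\<close> plus the death probability below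
    \<open>c\<close>.\<close>
  define f where "f n y = (u n y + (1 - surv n y)) - c * surv n y" for n y
  have "W k f n x = u n x + (alive k n x - surv n x) - c * surv n x" for k
  proof -
    have "f = (\<lambda>n y. (u n y + 1 *\<^sub>R 1) + (- 1 - c) *\<^sub>R surv n y)"
      by (auto simp: f_def fun_eq_iff algebra_simps)
    then show ?thesis
      using W_lincomb[of k "\<lambda>n y. u n y + 1 *\<^sub>R 1" "- 1 - c" surv n x]
        W_lincomb[of k u 1 "\<lambda>_ _. 1" n x]
        W_invariant[of u, OF u(2) x(1)] W_invariant[of surv, OF step_surv x(1)]
      by (simp add: alive_def algebra_simps)
  qed
  moreover have "(\<lambda>k. u n x + (alive k n x - surv n x) - c * surv n x)
      \<longlonglongrightarrow> u n x + (surv n x - surv n x) - c * surv n x"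
    by (intro tendsto_intros alive_tendsto x)
  ultimately have "\<forall>\<^sub>F k in sequentially. W k f n x < 0"
    using x(2) by (intro order_tendstoD) auto
  then obtain k where "W k f n x < 0" by (auto simp: eventually_sequentially)
  then obtain y where y: "y \<in> S" "f (n + k) y < 0"
    using W_nonneg[of f n k x] x(1) by (meson not_le)
  define m where "m = n + k"
  have lt: "u m y + (1 - surv m y) < c * surv m y"
    using y by (simp add: f_def m_def)
  also have lec: "\<dots> \<le> c" using mult_left_mono[OF surv_le_1[OF y(1), of m], of c] c by simp
  finally have lt_c: "u m y + (1 - surv m y) < c" .
  let ?P = "\<Sum>y'\<in>Q m y. p m y y'"
  \<comment> \<open>The one-step mass \<open>?P\<close> is at least the survival probability, hence
    at least \<open>1 / 2\<close>. A quantity whose expectation is below \<open>c\<close> over such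
    a mass is below \<open>2 * c\<close> at some successor.\<close>
  have "surv m y = step surv m y" using step_surv[OF y(1)] by simp
  also have "\<dots> \<le> step (\<lambda>_ _. 1) m y" using surv_le_1 y(1) by (intro step_mono) auto
  also have "\<dots> = ?P" by (simp add: step_def)
  finally have "1 / 2 \<le> ?P" using lt_c c u(1)[OF y(1), of m] by linarith
  then have P: "c \<le> 2 * c * ?P" using mult_left_mono[of "1 / 2" ?P "2 * c"] c by simp
  have "step (\<lambda>n y. u n y + (1 - surv n y) - 2 * c) m y = step u m y + ?P - step surv m y - 2 * c * ?P"
    by (simp add: step_def algebra_simps sum.distrib sum_subtractf sum_distrib_left)
  also have "\<dots> < 0"
    using u(2)[OF y(1), of m] step_surv[OF y(1), of m] lt_c P sum_p[OF y(1), of m] by linarith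
  finally obtain y' where "y' \<in> Q m y" "u (Suc m) y' + (1 - surv (Suc m) y') - 2 * c < 0"
    using p_nonneg[OF y(1)] unfolding step_def
    by (smt (verit) mult_nonneg_nonneg real_scaleR_def sum_nonneg)
  moreover have "u m y + (1 - surv m y) < 2 * c" using lt_c c by simp
  ultimately show thesis using that[OF y(1)] by auto
qed

text \<open>Starting near the supremum of \<psi>, \<open>good_successor\<close> yields a jump
  between two states that both almost surely survive. Their conditioned barycentres stay close to
  the states, so the jump remains visible, and both stay in the slice.\<close>

lemma slice_condbarys_large:
  fixes \<psi> :: "'a \<Rightarrow>\<^sub>L real"
  assumes sep: "\<And>n x y. x \<in> S \<Longrightarrow> y \<in> Q n x \<Longrightarrow> d \<le> dist x y"
    and d: "d > 0" "e \<le> d / 64" and bdd: "bounded condbarys"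
    and z0: "z0 \<in> condbarys" "b < \<psi> z0"
  obtains z z' where "z \<in> condbarys" "z' \<in> condbarys" "b < \<psi> z" "b < \<psi> z'" "d / 2 \<le> dist z z'"
proof -
  define M where "M = Sup (blinfun_apply \<psi> ` condbarys)"
  have M: "\<psi> z \<le> M" if "z \<in> condbarys" for z
    unfolding M_def using that bdd_above_blinfun_image[OF bdd] by (intro cSup_upper) auto
  have bM: "b < M" using M[OF z0(1)] z0(2) by simp
  \<comment> \<open>The harmonic function measuring the gap to the supremum \<open>M\<close>,
    weighted by survival.\<close>
  define u where "u n x = M * surv n x - \<psi> (lbary n x)" for n x
  have u_eq: "u n x = surv n x * (M - \<psi> (condbary n x))" if "0 < surv n x" for n x
    using that by (simp add: u_def condbary_def blinfun.scaleR_right field_simps)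
  have S: "bounded S" unfolding bounded_iff using norm_le_R by blast
  obtain B where B: "\<And>y. y \<in> S \<Longrightarrow> \<psi> y \<le> B"
    using bdd_above_blinfun_image[OF S] unfolding bdd_above_def by blast
  have u0: "0 \<le> u n x" if "x \<in> S" for n x
  \<comment> \<open>With zero survival there is no conditioned barycentre to compare with
    \<open>M\<close>; any bound \<open>B\<close> of \<psi> on \<open>S\<close> then gives that
    \<psi> is at most \<open>0\<close> at \<open>lbary n x\<close>.\<close>
  proof (cases "surv n x = 0")
    case True
    then show ?thesis using blinfun_lbary_le[of \<psi> B x n, OF B that] by (simp add: u_def)
  next
    case False
    then have "0 < surv n x" using surv_nonneg[OF that, of n] by simp
    moreover from this have "condbary n x \<in> condbarys" using that by (auto simp: condbarys_def)
    ultimately show ?thesis using M by (simp add: u_eq)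
  qed
  have u_step: "step u n x = u n x" if "x \<in> S" for n x
  proof -
    have "step u n x = M * step surv n x - \<psi> (step lbary n x)"
      unfolding u_def step_def
      by (simp add: algebra_simps sum_subtractf sum_distrib_left blinfun.sum_right blinfun.scaleR_right)
    then show ?thesis using that by (simp add: step_surv step_lbary u_def)
  qed
  obtain x1 where "x1 \<in> S" using z0 by (auto simp: condbarys_def)
  then have R: "R \<ge> 0" by (rule R_nonneg)
  \<comment> \<open>The three bounds serve, in order, to have survival above \<open>1 / 2\<close>,
    to keep the gap to \<open>M\<close> below \<open>4 * c \<le> M - b\<close>, and to have
    \<open>8 * R * c \<le> d / 8\<close>; \<open>R + 1\<close> avoids division by
    \<open>0\<close>.\<close>
  define c where "c = min (1 / 4) (min ((M - b) / 4) (d / (64 * (R + 1))))"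
  have "c > 0" using bM d R by (simp add: c_def)
  moreover have "c \<le> 1 / 4" "c \<le> (M - b) / 4" unfolding c_def by linarith+
  ultimately have c: "c > 0" "c \<le> 1 / 4" "4 * c \<le> M - b" by simp_all
  have "c \<le> d / (64 * (R + 1))" by (auto simp: c_def)
  then have "c * (64 * (R + 1)) \<le> d" using R by (subst (asm) pos_le_divide_eq) auto
  then have cR: "64 * (R * c) \<le> d" using c(1) by (simp add: algebra_simps)
  have "\<exists>z\<in>blinfun_apply \<psi> ` condbarys. M - c < z"
    using less_cSup_iff[of "blinfun_apply \<psi> ` condbarys" "M - c"] z0 c bdd_above_blinfun_image[OF bdd]
    unfolding M_def by auto
  then obtain n x where x: "x \<in> S" "0 < surv n x" "M - c < \<psi> (condbary n x)"
    by (auto simp: condbarys_def)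
  have lt: "u n x < c * surv n x" using x by (simp add: u_eq mult.commute)
  have c_half: "c \<le> 1 / 2" using c by simp
  obtain m y y' where y: "y \<in> S" "y' \<in> Q m y" "u m y + (1 - surv m y) < 2 * c"
    "u (Suc m) y' + (1 - surv (Suc m) y') < 2 * c"
    by (rule good_successor[OF u0 u_step x(1) lt c(1) c_half])
  have y': "y' \<in> S" using Q_sub y by blast
  have good: "condbary n y \<in> condbarys \<and> b < \<psi> (condbary n y) \<and> norm (condbary n y - y) \<le> 8 * R * c + 4 * e"
    if yn: "y \<in> S" "u n y + (1 - surv n y) < 2 * c" for n y
  proof -
    have s: "1 - surv n y < 2 * c" "u n y < 2 * c"
      using yn u0[of y n] surv_le_1[of y n] by auto
    then have s2: "1 / 2 < surv n y" using c by simp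
    have mem: "condbary n y \<in> condbarys" using yn s2 by (force simp: condbarys_def)
    have "1 / 2 * (M - \<psi> (condbary n y)) \<le> surv n y * (M - \<psi> (condbary n y))"
      using s2 M[OF mem] by (intro mult_right_mono) auto
    also have "\<dots> < 2 * c" using s(2) s2 by (simp add: u_eq)
    finally have "b < \<psi> (condbary n y)" using c(3) by simp
    with mem show ?thesis using condbary_dist[OF yn(1) s(1)] c by simp
  qed
  let ?z = "condbary m y" and ?z' = "condbary (Suc m) y'"
  note g = good[OF y(1,3)] good[OF y' y(4)]
  \<comment> \<open>Each barycentre is within \<open>d / 8 + d / 16\<close> of its state, so at
    least \<open>5 * d / 8\<close> of the jump remains.\<close>
  have "dist y y' \<le> norm (?z - y) + dist ?z ?z' + norm (?z' - y')"
    by (smt (verit) dist_norm dist_commute dist_triangle)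
  then have "d / 2 \<le> dist ?z ?z'"
    using sep[OF y(1,2)] g cR d by linarith
  then show thesis using that g by blast
qed

end

section \<open>Slices in sets with the Radon--Nikodym property\<close>

text \<open>Take a convex combination close to \<open>x\<close> and kill the points outside the
  half-space. Their contribution has norm at most \<open>R\<close> times the killed mass, and
  dropping them can only increase the sum of \<open>p y * (\<phi> y - a)\<close>, whose terms there
  are not positive.\<close>

lemma convex_hull_split_halfspace:
  fixes \<phi> :: "'a::real_normed_vector \<Rightarrow>\<^sub>L real"
  assumes z: "z \<in> convex hull K" "norm (z - x) \<le> e" and R: "\<And>k. k \<in> K \<Longrightarrow> norm k \<le> R"
  obtains Q p where "finite Q" "Q \<subseteq> {y \<in> K. a < \<phi> y}" "\<And>y. y \<in> Q \<Longrightarrow> 0 \<le> p y" "sum p Q \<le> 1"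
    "norm ((\<Sum>y\<in>Q. p y *\<^sub>R y) - x) \<le> R * (1 - sum p Q) + e"
    "\<phi> x - a \<le> (\<Sum>y\<in>Q. p y * (\<phi> y - a)) + norm \<phi> * e"
proof -
  obtain T p where T: "finite T" "T \<subseteq> K" "\<And>y. y \<in> T \<Longrightarrow> 0 \<le> p y" "sum p T = 1"
    "(\<Sum>y\<in>T. p y *\<^sub>R y) = z"
    using z(1) unfolding convex_hull_explicit by blast
  define Q where "Q = {y \<in> T. a < \<phi> y}"
  have split: "sum g T = sum g Q + sum g (T - Q)" for g :: "'a \<Rightarrow> 'b::comm_monoid_add"
    using sum.subset_diff[of Q T g] T(1) by (simp add: Q_def add.commute)
  have dead: "sum p (T - Q) = 1 - sum p Q" using split[of p] T(4) by simp
  have dead_nonneg: "0 \<le> sum p (T - Q)" using T(3) by (intro sum_nonneg) auto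
  show thesis
  proof
    show "finite Q" "Q \<subseteq> {y \<in> K. a < \<phi> y}" "\<And>y. y \<in> Q \<Longrightarrow> 0 \<le> p y"
      using T by (auto simp: Q_def)
    show "sum p Q \<le> 1" using dead dead_nonneg by simp
    have "norm (\<Sum>y\<in>T - Q. p y *\<^sub>R y) \<le> (\<Sum>y\<in>T - Q. p y * R)"
      using T R by (intro sum_norm_le) (auto intro!: mult_left_mono)
    also have "\<dots> = R * (1 - sum p Q)" by (simp add: dead flip: sum_distrib_right)
    finally have "norm (\<Sum>y\<in>T - Q. p y *\<^sub>R y) \<le> R * (1 - sum p Q)" .
    moreover have eq: "(\<Sum>y\<in>Q. p y *\<^sub>R y) - x = (z - x) - (\<Sum>y\<in>T - Q. p y *\<^sub>R y)"
      using split[of "\<lambda>y. p y *\<^sub>R y"] T(5) by simp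
    ultimately show "norm ((\<Sum>y\<in>Q. p y *\<^sub>R y) - x) \<le> R * (1 - sum p Q) + e"
      using norm_triangle_ineq4[of "z - x" "\<Sum>y\<in>T - Q. p y *\<^sub>R y"] z(2)
      unfolding eq by linarith
    have "\<phi> (x - z) \<le> norm \<phi> * norm (x - z)"
      using norm_blinfun[of \<phi> "x - z"] by simp
    also have "\<dots> \<le> norm \<phi> * e"
      using z(2) by (intro mult_left_mono) (auto simp: norm_minus_commute)
    finally have "\<phi> x - a \<le> (\<phi> z - a) + norm \<phi> * e" by (simp add: blinfun.diff_right)
    also have "\<phi> z - a = (\<Sum>y\<in>T. p y * (\<phi> y - a))"
      using T(4) unfolding T(5)[symmetric]
      by (simp add: blinfun.sum_right blinfun.scaleR_right right_diff_distrib sum_subtractf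
          flip: sum_distrib_right)
    also have "\<dots> \<le> (\<Sum>y\<in>Q. p y * (\<phi> y - a))"
    proof -
      have "(\<Sum>y\<in>T - Q. p y * (\<phi> y - a)) \<le> 0"
        using T(3) by (intro sum_nonpos) (auto simp: Q_def mult_nonneg_nonpos)
      then show ?thesis using split[of "\<lambda>y. p y * (\<phi> y - a)"] by simp
    qed
    finally show "\<phi> x - a \<le> (\<Sum>y\<in>Q. p y * (\<phi> y - a)) + norm \<phi> * e" by simp
  qed
qed

text \<open>If no subslice is small, separation produces a kernel at every point of the slice
  \<open>S\<close>. The property is then applied to the conditioned barycentres of the resulting
  walk instead of \<open>A\<close>.\<close>

lemma radon_nikodym_small_subslice:
  fixes C :: "'a::banach set" and \<phi> :: "'a \<Rightarrow>\<^sub>L real"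
  assumes rnp: "radon_nikodym_property C" and C: "closed C" "convex C"
    and A: "A \<subseteq> C" "bounded A" and x0: "x0 \<in> A" "a < \<phi> x0" and d: "d > 0"
  obtains \<psi> :: "'a \<Rightarrow>\<^sub>L real" and b y where "\<exists>x\<in>A. b < \<psi> x"
    "\<And>x. x \<in> A \<Longrightarrow> b < \<psi> x \<Longrightarrow> x \<in> ball y d \<and> a < \<phi> x"
proof (rule ccontr)
  assume "\<not> thesis"
  with that have no: False
    if "\<exists>x\<in>A. b < \<psi> x" "\<And>x. x \<in> A \<Longrightarrow> b < \<psi> x \<Longrightarrow> x \<in> ball y d \<and> a < \<phi> x"
    for \<psi> :: "'a \<Rightarrow>\<^sub>L real" and b y
    using that by blast
  define S where "S = {x \<in> A. a < \<phi> x}"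
  obtain R where R: "\<And>x. x \<in> A \<Longrightarrow> norm x \<le> R"
    using A(2) unfolding bounded_iff by blast
  \<comment> \<open>The first bound is the one required by \<open>slice_condbarys_large\<close>; the
    second keeps the accumulated error of \<open>surv_lower\<close> below
    \<open>\<phi> x0 - a\<close>.\<close>
  define e where "e = min (d / 64) ((\<phi> x0 - a) / (4 * (norm \<phi> + 1)))"
  have "e > 0" using d x0 by (simp add: e_def add_nonneg_pos)
  moreover have "e \<le> d / 64" unfolding e_def by (rule min.cobounded1)
  ultimately have e: "e > 0" "e \<le> d / 64" .
  have "e \<le> (\<phi> x0 - a) / (4 * (norm \<phi> + 1))" by (simp add: e_def)
  then have "e * (4 * (norm \<phi> + 1)) \<le> \<phi> x0 - a"
    by (subst (asm) pos_le_divide_eq) (auto simp: add_nonneg_pos)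
  then have e_small: "2 * norm \<phi> * e < \<phi> x0 - a"
  proof -
    have "e * (4 * (norm \<phi> + 1)) = 4 * e + 2 * (2 * norm \<phi> * e)" by (simp add: algebra_simps)
    moreover have "0 \<le> 2 * norm \<phi> * e" using e(1) by simp
    ultimately show ?thesis
      using \<open>e * (4 * (norm \<phi> + 1)) \<le> \<phi> x0 - a\<close> e(1) by linarith
  qed
  define kernel where "kernel n x Q p \<longleftrightarrow> finite Q \<and> (\<forall>y\<in>Q. y \<in> S \<and> d \<le> dist x y \<and> 0 \<le> p y) \<and> sum p Q \<le> 1 \<and>
    norm ((\<Sum>y\<in>Q. p y *\<^sub>R y) - x) \<le> R * (1 - sum p Q) + e / 2 ^ n \<and>
    \<phi> x - a \<le> (\<Sum>y\<in>Q. p y * (\<phi> y - a)) + norm \<phi> * (e / 2 ^ n)"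
    for n :: nat and x Q and p :: "'a \<Rightarrow> real"
  have "\<exists>Q p. kernel n x Q p" if x: "x \<in> S" for n x
  proof -
    \<comment> \<open>Points outside the half-space stay in \<open>K\<close> even when close to
      \<open>x\<close>: they become killed mass, whereas the surviving points of \<open>K\<close>
      are at distance at least \<open>d\<close> from \<open>x\<close>.\<close>
    define K where "K = A - (ball x d \<inter> {y. a < \<phi> y})"
    have "x \<in> closure (convex hull K)"
    proof (rule ccontr)
      assume "x \<notin> closure (convex hull K)"
      then obtain \<psi> :: "'a \<Rightarrow>\<^sub>L real" and b where b: "\<And>k. k \<in> K \<Longrightarrow> \<psi> k \<le> b" "b < \<psi> x"
        by (rule separate_point_closure_convex_hull) blast
      show False
      proof (rule no)
        show "\<exists>x\<in>A. b < \<psi> x" using b(2) x by (auto simp: S_def)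
        show "y \<in> ball x d \<and> a < \<phi> y" if "y \<in> A" "b < \<psi> y" for y
          using b(1)[of y] that by (auto simp: K_def)
      qed
    qed
    moreover have "e / 2 ^ n > 0" using e by simp
    ultimately obtain z where z: "z \<in> convex hull K" "dist z x < e / 2 ^ n"
      unfolding closure_approachable by blast
    have z': "norm (z - x) \<le> e / 2 ^ n" using z(2) by (simp add: dist_norm)
    have RK: "norm k \<le> R" if "k \<in> K" for k using R that by (auto simp: K_def)
    obtain Q p where "finite Q" "Q \<subseteq> {y \<in> K. a < \<phi> y}" "\<And>y. y \<in> Q \<Longrightarrow> 0 \<le> p y" "sum p Q \<le> 1"
      "norm ((\<Sum>y\<in>Q. p y *\<^sub>R y) - x) \<le> R * (1 - sum p Q) + e / 2 ^ n"
      "\<phi> x - a \<le> (\<Sum>y\<in>Q. p y * (\<phi> y - a)) + norm \<phi> * (e / 2 ^ n)"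
      using convex_hull_split_halfspace[OF z(1) z' RK] by blast
    moreover have "{y \<in> K. a < \<phi> y} \<subseteq> {y \<in> S. d \<le> dist x y}"
      by (auto simp: K_def S_def)
    ultimately have "kernel n x Q p" unfolding kernel_def by blast
    then show ?thesis by blast
  qed
  then have "\<forall>n x. \<exists>Q p. x \<in> S \<longrightarrow> kernel n x Q p" by blast
  then obtain Q p where "\<forall>n x. x \<in> S \<longrightarrow> kernel n x (Q n x) (p n x)"
    unfolding choice_iff by (elim exE)
  then have kernel_Qp: "kernel n x (Q n x) (p n x)" if "x \<in> S" for n x
    using that by blast
  note kernel = kernel_Qp[unfolded kernel_def]
  interpret killed_walk Q p S R e
  proof
    show "norm x \<le> R" if "x \<in> S" for x using R that by (auto simp: S_def)
  qed (use kernel e in auto)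
  obtain g where g: "\<And>x. x \<in> A \<Longrightarrow> \<phi> x \<le> g"
    using bdd_above_blinfun_image[OF A(2), of \<phi>] unfolding bdd_above_def by blast
  have x0S: "x0 \<in> S" using x0 by (simp add: S_def)
  have "\<phi> x0 - a \<le> (g - a) * surv 0 x0 + 2 * norm \<phi> * (e / 2 ^ 0)"
  proof (rule surv_lower[of "\<lambda>x. \<phi> x - a"])
    show "\<phi> x - a \<le> step (\<lambda>_ x. \<phi> x - a) n x + norm \<phi> * (e / 2 ^ n)" if "x \<in> S" for n x
      using kernel[OF that, of n] by (simp add: step_def)
    show "\<phi> x - a \<le> g - a" if "x \<in> S" for x using g that by (auto simp: S_def)
  qed (use x0S in auto)
  then have "surv 0 x0 \<noteq> 0" using e_small by auto
  then have "0 < surv 0 x0" using surv_nonneg[OF x0S, of 0] by simp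
  then have "condbarys \<noteq> {}" using x0S by (auto simp: condbarys_def)
  \<comment> \<open>Conditioned barycentres may leave \<open>A\<close>, but not the closed convex
    set \<open>C\<close>.\<close>
  have "closure (convex hull S) \<subseteq> C"
    using A C by (intro closure_convex_hull_minimal) (auto simp: S_def)
  then have sub: "condbarys \<subseteq> C" using condbarys_subset by blast
  have "bounded S" using A(2) by (rule bounded_subset) (auto simp: S_def)
  then have bdd: "bounded condbarys"
    by (intro bounded_subset[OF _ condbarys_subset] bounded_closure bounded_convex_hull)
  have "\<exists>H. open_halfspace H \<and> condbarys \<inter> H \<noteq> {} \<and>
      diam dist ((\<lambda>x. x) ` (condbarys \<inter> H)) < ennreal (d / 2)"
    using rnp d sub bdd \<open>condbarys \<noteq> {}\<close>
    unfolding radon_nikodym_property_def dentable_on_def by simp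
  then obtain \<psi> :: "'a \<Rightarrow>\<^sub>L real" and b where
    ne: "condbarys \<inter> {x. b < \<psi> x} \<noteq> {}" and
    small: "diam dist ((\<lambda>x. x) ` (condbarys \<inter> {x. b < \<psi> x})) < ennreal (d / 2)"
    unfolding open_halfspace_def by blast
  from ne obtain z0 where z0: "z0 \<in> condbarys" "b < \<psi> z0" by blast
  have sep: "d \<le> dist x y" if "x \<in> S" "y \<in> Q n x" for n x y
    using kernel[OF that(1), of n] that(2) by blast
  obtain z z' where z: "z \<in> condbarys" "z' \<in> condbarys" "b < \<psi> z" "b < \<psi> z'"
    "d / 2 \<le> dist z z'"
    by (rule slice_condbarys_large[OF sep d e(2) bdd z0])
  have "dist z z' < d / 2" by (rule diam_lessD[OF small]) (use z in auto)
  with z(5) show False by simp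
qed

section \<open>Dentability of continuous and of Lipschitz maps\<close>

lemma radon_nikodym_imp_dentable:
  fixes C :: "'a::banach set" and M :: "'m set"
  assumes rnp: "radon_nikodym_property C" and C: "closed C" "convex C"
    and M: "Metric_space M d" and f: "continuous_map (top_of_set C) (Metric_space.mtopology M d) f"
  shows "dentable_on C d f"
  unfolding dentable_on_def
proof (intro allI impI, elim conjE)
  interpret Metric_space M d by (rule M)
  fix A and e :: real
  assume A: "A \<subseteq> C" "A \<noteq> {}" "bounded A" and e: "e > 0"
  \<comment> \<open>Every set of the nested sequence is cut from \<open>A\<close> itself by one
    half-space, as dentability asks.\<close>
  define slice where "slice U \<longleftrightarrow> U \<noteq> {} \<and> (\<exists>(\<psi> :: 'a \<Rightarrow>\<^sub>L real) b. U = A \<inter> {x. b < \<psi> x})" for U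
  have "\<exists>U. \<forall>n. slice (U n) \<and> (U (Suc n) \<subseteq> U n \<and> (\<exists>y. U (Suc n) \<subseteq> ball y (1 / real (Suc n))))"
  proof (rule dependent_nat_choice)
    \<comment> \<open>The zero functional makes \<open>A\<close> a slice of itself.\<close>
    have "A = A \<inter> {x. - 1 < (0 :: 'a \<Rightarrow>\<^sub>L real) x}" by auto
    then show "\<exists>U. slice U" using A(2) unfolding slice_def by blast
  next
    fix U n assume "slice U"
    then obtain \<phi> :: "'a \<Rightarrow>\<^sub>L real" and a x0 where U: "U = A \<inter> {x. a < \<phi> x}" "x0 \<in> A" "a < \<phi> x0"
      unfolding slice_def by blast
    obtain \<psi> :: "'a \<Rightarrow>\<^sub>L real" and b y where V: "\<exists>x\<in>A. b < \<psi> x"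
      "\<And>x. x \<in> A \<Longrightarrow> b < \<psi> x \<Longrightarrow> x \<in> ball y (1 / real (Suc n)) \<and> a < \<phi> x"
      by (rule radon_nikodym_small_subslice[OF rnp C A(1,3) U(2,3), of "1 / real (Suc n)"]) auto
    let ?V = "A \<inter> {x. b < \<psi> x}"
    have "slice ?V" "?V \<subseteq> U" "?V \<subseteq> ball y (1 / real (Suc n))"
      using V unfolding slice_def U(1) by blast+
    then show "\<exists>V. slice V \<and> (V \<subseteq> U \<and> (\<exists>y. V \<subseteq> ball y (1 / real (Suc n))))" by blast
  qed
  then obtain U y where U: "\<And>n. slice (U n)" "\<And>n. U (Suc n) \<subseteq> U n"
    and y: "\<And>n. U (Suc n) \<subseteq> ball (y n) (1 / real (Suc n))" by metis
  have UA: "U n \<subseteq> A" for n using U(1)[of n] by (auto simp: slice_def)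
  have "\<exists>x. x \<in> U n" for n using U(1)[of n] by (auto simp: slice_def)
  then obtain a where a: "\<And>n. a n \<in> U n" by metis
  have "decseq U" using U(2) by (rule decseq_SucI)
  then have a_mem: "a k \<in> U n" if "n \<le> k" for n k
    using a[of k] that by (auto dest: decseqD)
  have near: "dist (y n) (a k) < 1 / real (Suc n)" if "Suc n \<le> k" for n k
    using y[of n] a_mem[OF that] by auto
  have "Cauchy a"
  proof (rule metric_CauchyI)
    fix r :: real assume "r > 0"
    then obtain n where n: "inverse (real (Suc n)) < r / 2" using reals_Archimedean[of "r / 2"] by auto
    have "dist (a i) (a j) < r" if "Suc n \<le> i" "Suc n \<le> j" for i j
      using near[OF that(1)] near[OF that(2)] n dist_triangle3[of "a i" "a j" "y n"]
      by (simp add: inverse_eq_divide)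
    then show "\<exists>N. \<forall>i\<ge>N. \<forall>j\<ge>N. dist (a i) (a j) < r" by blast
  qed
  then obtain x where x: "a \<longlonglongrightarrow> x" by (auto simp: Cauchy_convergent_iff convergent_def)
  \<comment> \<open>The limit need not belong to \<open>A\<close>; closedness puts it in
    \<open>C\<close>, where \<open>f\<close> is continuous.\<close>
  have xC: "x \<in> C"
    by (rule closed_sequentially[OF C(1) _ x]) (use a UA A(1) in blast)
  have "e / 3 > 0" using e by simp
  then obtain V where V: "openin (top_of_set C) V" "x \<in> V" "\<And>z. z \<in> V \<Longrightarrow> f z \<in> mball (f x) (e / 3)"
    using f xC unfolding continuous_map_to_metric by (metis topspace_euclidean_subtopology)
  obtain r where r: "r > 0" "ball x r \<inter> C \<subseteq> V"
    using V(1,2) unfolding openin_contains_ball by blast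
  obtain n where n: "inverse (real (Suc n)) < r / 2" using reals_Archimedean[of "r / 2"] r by auto
  \<comment> \<open>So the limit is as close to the centre \<open>y n\<close> as the points of
    \<open>U (Suc n)\<close> are, and twice this radius is below \<open>r\<close>.\<close>
  have "dist (y n) x \<le> 1 / real (Suc n)"
  proof (rule LIMSEQ_le_const2)
    show "(\<lambda>k. dist (y n) (a k)) \<longlonglongrightarrow> dist (y n) x" by (intro tendsto_intros x)
    show "\<exists>N. \<forall>k\<ge>N. dist (y n) (a k) \<le> 1 / real (Suc n)" using near less_imp_le by blast
  qed
  then have "dist x z < r" if "z \<in> U (Suc n)" for z
    using subsetD[OF y that] n dist_triangle3[of x z "y n"] by (simp add: inverse_eq_divide)
  then have "U (Suc n) \<subseteq> ball x r" by auto
  then have UV: "U (Suc n) \<subseteq> V" using r(2) UA A(1) by blast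
  have "d (f p) (f q) \<le> 2 * e / 3" if pq: "p \<in> U (Suc n)" "q \<in> U (Suc n)" for p q
  proof -
    have m: "f p \<in> mball (f x) (e / 3)" "f q \<in> mball (f x) (e / 3)" using V(3) UV pq by blast+
    then have "d (f p) (f q) \<le> d (f p) (f x) + d (f x) (f q)"
      by (intro triangle) auto
    then show ?thesis using m by (simp add: commute)
  qed
  then have "diam d (f ` U (Suc n)) < ennreal e"
    using e by (intro diam_lessI[where e = "2 * e / 3"]) auto
  moreover obtain \<psi> :: "'a \<Rightarrow>\<^sub>L real" and b where "U (Suc n) = A \<inter> {x. b < \<psi> x}"
    using U(1)[of "Suc n"] by (auto simp: slice_def)
  moreover have "U (Suc n) \<noteq> {}" using a by blast
  moreover have "open_halfspace {x. b < \<psi> x}" by (auto simp: open_halfspace_def)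
  ultimately show "\<exists>H. open_halfspace H \<and> A \<inter> H \<noteq> {} \<and> diam d (f ` (A \<inter> H)) < ennreal e"
    by metis
qed

text \<open>Uniform continuity makes a single slice of diameter below \<open>r\<close> enough, in
  contrast to the nested slices used for a merely continuous map.\<close>

lemma radon_nikodym_imp_lipschitz_dentable:
  fixes f :: "'a::real_normed_vector \<Rightarrow> 'b::metric_space"
  assumes rnp: "radon_nikodym_property C" and f: "L-lipschitz_on C f"
  shows "dentable_on C dist f"
  unfolding dentable_on_def
proof (intro allI impI, elim conjE)
  fix A and e :: real
  assume A: "A \<subseteq> C" "A \<noteq> {}" "bounded A" and e: "e > 0"
  have L: "0 \<le> L" using f by (rule lipschitz_on_nonneg)
  define r where "r = e / (2 * (L + 1))"
  have r: "r > 0" "L * r \<le> e / 2"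
    using e L by (auto simp: r_def field_simps add_nonneg_pos)
  have "\<exists>H. open_halfspace H \<and> A \<inter> H \<noteq> {} \<and> diam dist ((\<lambda>x. x) ` (A \<inter> H)) < ennreal r"
    using rnp A r(1) unfolding radon_nikodym_property_def dentable_on_def by simp
  then obtain H where H: "open_halfspace H" "A \<inter> H \<noteq> {}"
    "diam dist ((\<lambda>x. x) ` (A \<inter> H)) < ennreal r" by blast
  have "diam dist (f ` (A \<inter> H)) < ennreal e"
  proof (rule diam_lessI)
    fix u v assume "u \<in> f ` (A \<inter> H)" "v \<in> f ` (A \<inter> H)"
    then obtain p q where pq: "p \<in> A \<inter> H" "q \<in> A \<inter> H" "u = f p" "v = f q" by blast
    have "dist p q < r" using diam_lessD[OF H(3)] pq by auto
    then have "L * dist p q \<le> e / 2" using r L mult_left_mono[of "dist p q" r L] by linarith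
    moreover have "dist u v \<le> L * dist p q"
      using lipschitz_onD[OF f] pq A(1) by blast
    ultimately show "dist u v \<le> e / 2" by simp
  qed (use e in auto)
  with H(1,2) show "\<exists>H. open_halfspace H \<and> A \<inter> H \<noteq> {} \<and> diam dist (f ` (A \<inter> H)) < ennreal e"
    by blast
qed

section \<open>The equivalences\<close>

theorem proposition3p1:
  fixes C :: "'a::banach set"
  assumes "closed C" and "convex C"
  shows
    "(radon_nikodym_property C \<longleftrightarrow>
        (\<forall>(M :: 'a set) d f. Metric_space M d \<and>
           continuous_map (top_of_set C) (Metric_space.mtopology M d) f \<longrightarrow> dentable_on C d f)) \<and>
     (radon_nikodym_property C \<longleftrightarrow>
        (\<forall>f :: 'a \<Rightarrow> real. (\<exists>L. L-lipschitz_on C f) \<longrightarrow> dentable_on C dist f)) \<and>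
     (radon_nikodym_property C \<longrightarrow>
        (\<forall>(M :: 'm set) d f. Metric_space M d \<and>
           continuous_map (top_of_set C) (Metric_space.mtopology M d) f \<longrightarrow> dentable_on C d f))"
proof -
  let ?cont = "\<lambda>M d f. Metric_space M d \<and> continuous_map (top_of_set C) (Metric_space.mtopology M d) f"
  have i_ii: "dentable_on C d f" if "radon_nikodym_property C" "?cont M d f"
    for M :: "'a set" and d f
    using radon_nikodym_imp_dentable[OF that(1) assms] that(2) by blast
  have i_ii': "dentable_on C d f" if "radon_nikodym_property C" "?cont M d f"
    for M :: "'m set" and d f
    using radon_nikodym_imp_dentable[OF that(1) assms] that(2) by blast
  have ii_i: "radon_nikodym_property C"
    if "\<forall>(M :: 'a set) d f. ?cont M d f \<longrightarrow> dentable_on C d f"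
  proof -
    \<comment> \<open>Condition (ii) is applied to the identity, with the whole space under its norm
      metric as target.\<close>
    have "?cont (UNIV :: 'a set) dist (\<lambda>x. x)"
      using Met_TC.Metric_space_axioms by simp
    then have "dentable_on C dist (\<lambda>x :: 'a. x)"
      by (rule that[THEN spec, THEN spec, THEN spec, THEN mp])
    then show ?thesis by (simp add: radon_nikodym_property_def)
  qed
  have i_iii: "dentable_on C dist f" if "radon_nikodym_property C" "\<exists>L. L-lipschitz_on C f"
    for f :: "'a \<Rightarrow> real"
    using that radon_nikodym_imp_lipschitz_dentable by blast
  have iii_i: "radon_nikodym_property C"
    if "\<forall>f :: 'a \<Rightarrow> real. (\<exists>L. L-lipschitz_on C f) \<longrightarrow> dentable_on C dist f"
    using that by (intro radon_nikodym_property_if_lipschitz_dentable) blast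
  show ?thesis
    by (intro conjI[OF iffI conjI[OF iffI]] allI impI)
      (rule i_ii i_ii' i_iii ii_i iii_i; assumption)+
qed

end
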